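(* Let $\Bbbk$ be a field and let $T=\Bbbk[x,y]$ be the polynomial ring with the $\mathbb{Z}^2$-grading (bigrading) $\deg(x)=(1,0)$ and $\deg(y)=(0,1)$. Let $M$ be a bigraded $T$-module of finite length. If its matching graph $\Gamma(M)$ is $(1,1)$-valent and connected, then the bigraded Betti table $\beta^T(M)$ is extremal.
   Context: Betti numbers. For a bigraded $T$-module $M$ of finite length, the bigraded Betti numbers are $\beta^T_{i,\alpha}(M)=\dim_{\Bbbk}\operatorname{Tor}^T_i(M,\Bbbk)_{\alpha}$ for $i\in\{0,1,2\}$ and $\alpha\in\mathbb{Z}^2$. Equivalently, $\beta^T_{i,\alpha}(M)$ is the number of minimal generators of bidegree $\alpha$ of $\mathbf{F}_i$, where $\mathbf{F}=[\mathbf{F}_0\leftarrow\mathbf{F}_1\leftarrow\mathbf{F}_2\leftarrow 0]$ is the bigraded minimal free resolution of $M$. The bigraded Betti table $\beta^T(M)$ is the vector in $\bigoplus_{i=0}^{2}\bigoplus_{\alpha\in\mathbb{Z}^2}\mathbb{Q}$ with coordinates $\beta^T_{i,\alpha}(M)$. Extremality. For a bigraded $T$-module $M$ of finite length, $\beta^T(M)$ is called extremal if, for any decomposition of the form $\beta^T(M)=\beta^T(M')+\beta^T(M'')$ with $M',M''$ bigraded $T$-modules, $\beta^T(M')$ is a scalar multiple of $\beta^T(M)$. Extremal Betti tables correspond to extremal rays of the cone of Betti tables of finite length modules, i.e. the cone $\mathbb{Q}_{\ge 0}\cdot\{\beta^T(M)\mid M \text{ a bigraded } T\text{-module of finite length}\}$.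 Matching graph. The matching graph $\Gamma(M)$ of a bigraded $T$-module $M$ of finite length is a graph whose vertices have weights in $\mathbb{Z}$ and whose edges are of two types, $x$-edges and $y$-edges. The vertices correspond to the bidegrees of the generators of the $\mathbf{F}_i$, that is, the vertex set is the set of $\alpha\in\mathbb{Z}^2$ such that $\beta^T_{i,\alpha}(M)\neq 0$ for some $i$; the vertex $\alpha$ has weight $\beta^T_{0,\alpha}(M)+\beta^T_{1,\alpha}(M)+\beta^T_{2,\alpha}(M)$. There is an $x$-edge between any two (distinct) vertices with the same $x$-degree (first coordinate), and a $y$-edge between any two (distinct) vertices with the same $y$-degree (second coordinate). Valency and connectedness. A vertex of $\Gamma(M)$ has valency $(a,b)$ if it meets precisely $a$ of the $x$-edges and precisely $b$ of the $y$-edges. The graph $\Gamma(M)$ is $(a,b)$-valent if all of its vertices have valency $(a,b)$. The graph $\Gamma(M)$ is connected if the underlying graph (on the same vertices, with edges the union of the $x$-edges and $y$-edges) is connected. *)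

theory Defs
  imports
    "HOL.Rat"
    "HOL.Vector_Spaces"
    "HOL-Library.Poly_Mapping"
    "HOL-Library.Product_Plus"
    "HOL-Library.Function_Algebras"
begin

section \<open>Bigraded modules over \<open>T = k[x,y]\<close>\<close>

text \<open>A polynomial is its coefficient function: the exponent pair \<open>(i, j)\<close> stands for the
  monomial \<open>x^i y^j\<close>, so multiplication in \<open>T\<close> is the convolution product of
  \<^theory>\<open>HOL-Library.Poly_Mapping\<close>.\<close>

type_synonym 'k bipoly = "(nat \<times> nat) \<Rightarrow>\<^sub>0 'k"

type_synonym bideg = "int \<times> int"

abbreviation monom2 :: "nat \<times> nat \<Rightarrow> 'k::zero \<Rightarrow> 'k bipoly" where
  "monom2 \<equiv> Poly_Mapping.single"

abbreviation polyX :: "'k::field bipoly" where "polyX \<equiv> monom2 (1, 0) 1"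
abbreviation polyY :: "'k::field bipoly" where "polyY \<equiv> monom2 (0, 1) 1"

definition bideg_of :: "nat \<times> nat \<Rightarrow> bideg" where
  "bideg_of n = (int (fst n), int (snd n))"

definition homogeneous :: "bideg \<Rightarrow> 'k::zero bipoly \<Rightarrow> bool" where
  "homogeneous \<alpha> p \<longleftrightarrow> (\<forall>n. Poly_Mapping.lookup p n \<noteq> 0 \<longrightarrow> bideg_of n = \<alpha>)"

text \<open>The underlying module is a whole type with scalar multiplication \<open>s\<close>, and \<open>G \<alpha>\<close> is its
  component of bidegree \<open>\<alpha>\<close>. That \<open>G \<alpha>\<close> is a \<open>k\<close>-subspace is the case \<open>\<beta> = 0\<close> of
  \<open>scale_closed\<close>.\<close>

locale bigraded_module = module s
  for s :: "'k::field bipoly \<Rightarrow> 'm::ab_group_add \<Rightarrow> 'm" +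
  fixes G :: "bideg \<Rightarrow> 'm set"
  assumes zero_closed: "0 \<in> G \<alpha>"
    and add_closed: "u \<in> G \<alpha> \<Longrightarrow> v \<in> G \<alpha> \<Longrightarrow> u + v \<in> G \<alpha>"
    and scale_closed: "homogeneous \<beta> p \<Longrightarrow> u \<in> G \<alpha> \<Longrightarrow> s p u \<in> G (\<alpha> + \<beta>)"
    and direct_sum: "\<exists>!f. finite {\<alpha>. f \<alpha> \<noteq> 0} \<and> (\<forall>\<alpha>. f \<alpha> \<in> G \<alpha>) \<and> u = (\<Sum>\<alpha> | f \<alpha> \<noteq> 0. f \<alpha>)"

text \<open>Finite length: the strict chains of \<open>T\<close>-submodules have bounded length.\<close>

definition finite_length :: "('k::field bipoly \<Rightarrow> 'm::ab_group_add \<Rightarrow> 'm) \<Rightarrow> bool" where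
  "finite_length s \<longleftrightarrow>
     (\<exists>N. \<forall>n C. (\<forall>i\<le>n. module.subspace s (C i)) \<and> (\<forall>i<n. C i \<subset> C (Suc i)) \<longrightarrow> n \<le> N)"


section \<open>Complexes of free bigraded modules, and Tor\<close>

text \<open>A complex \<open>F\<close> of finitely generated free bigraded \<open>T\<close>-modules: \<open>degs F i\<close> lists the
  bidegrees of a basis of \<open>F_i\<close>, and \<open>coef F i r c\<close> is the coefficient of the \<open>r\<close>-th basis
  element of \<open>F_(i-1)\<close> in the image of the \<open>c\<close>-th basis element of \<open>F_i\<close>.\<close>

record (overloaded) 'k free_complex =
  degs :: "nat \<Rightarrow> bideg list"
  coef :: "nat \<Rightarrow> nat \<Rightarrow> nat \<Rightarrow> 'k bipoly"

abbreviation rk :: "'k::zero free_complex \<Rightarrow> nat \<Rightarrow> nat" where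
  "rk F i \<equiv> length (degs F i)"

text \<open>The complex \<open>M \<otimes> F\<close>. The chain \<open>u\<close> stands for the sum of the \<open>u c \<otimes> e_c\<close>; it is
  homogeneous of bidegree \<open>\<alpha>\<close> iff each \<open>u c\<close> has bidegree \<open>\<alpha> - deg e_c\<close>. Taking for \<open>M\<close> the
  ring \<open>T\<close> itself (\<open>s = (*)\<close>) gives back \<open>F\<close>.\<close>

definition free_chains :: "'k::zero free_complex \<Rightarrow> nat \<Rightarrow> (nat \<Rightarrow> 'm::zero) set" where
  "free_chains F i = {u. \<forall>c. rk F i \<le> c \<longrightarrow> u c = 0}"

definition free_chains_at ::
  "(bideg \<Rightarrow> 'm::zero set) \<Rightarrow> 'k::zero free_complex \<Rightarrow> nat \<Rightarrow> bideg \<Rightarrow> (nat \<Rightarrow> 'm) set" where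
  "free_chains_at G F i \<alpha> = {u \<in> free_chains F i. \<forall>c<rk F i. u c \<in> G (\<alpha> - degs F i ! c)}"

definition bd ::
  "('k::zero bipoly \<Rightarrow> 'm \<Rightarrow> 'm) \<Rightarrow> 'k free_complex \<Rightarrow> nat \<Rightarrow> (nat \<Rightarrow> 'm) \<Rightarrow> nat \<Rightarrow> 'm::comm_monoid_add" where
  "bd s F i u =
     (\<lambda>r. if 0 < i \<and> r < rk F (i - 1) then (\<Sum>c<rk F i. s (coef F i r c) (u c)) else 0)"

definition chain_scale ::
  "('k::zero bipoly \<Rightarrow> 'm \<Rightarrow> 'm) \<Rightarrow> 'k \<Rightarrow> (nat \<Rightarrow> 'm) \<Rightarrow> nat \<Rightarrow> 'm" where
  "chain_scale s a u = (\<lambda>c. s (monom2 0 a) (u c))"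

definition homology_dim ::
  "('k::field bipoly \<Rightarrow> 'm::ab_group_add \<Rightarrow> 'm) \<Rightarrow> (bideg \<Rightarrow> 'm set) \<Rightarrow> 'k free_complex
     \<Rightarrow> nat \<Rightarrow> bideg \<Rightarrow> nat" where
  "homology_dim s G F i \<alpha> =
     vector_space.dim (chain_scale s) {u \<in> free_chains_at G F i \<alpha>. bd s F i u = 0}
     - vector_space.dim (chain_scale s) (bd s F (Suc i) ` free_chains_at G F (Suc i) \<alpha>)"

text \<open>Bigraded free resolutions of the residue field \<open>k = T/(x,y)\<close> with \<open>F_0 = T\<close>.\<close>

definition residue_field_resolution :: "'k::field free_complex \<Rightarrow> bool" where
  "residue_field_resolution F \<longleftrightarrow>
     (\<forall>i>0. \<forall>r<rk F (i - 1). \<forall>c<rk F i.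
        homogeneous (degs F i ! c - degs F (i - 1) ! r) (coef F i r c)) \<and>
     degs F 0 = [(0, 0)] \<and>
     bd (*) F 1 ` free_chains F 1 = {u \<in> free_chains F 0. Poly_Mapping.lookup (u 0) 0 = 0} \<and>
     (\<forall>i>0. {u \<in> free_chains F i. bd (*) F i u = 0} = bd (*) F (Suc i) ` free_chains F (Suc i))"

text \<open>The resolution \<open>0 \<rightarrow> T(-1,-1) \<rightarrow> T(-1,0) \<oplus> T(0,-1) \<rightarrow> T\<close> of \<open>k\<close>, with
  differentials \<open>(x, y)\<close> and \<open>(-y, x)\<close>.\<close>

definition koszul :: "'k::field free_complex" where
  "koszul = \<lparr>
     degs = (\<lambda>i. if i = 0 then [(0, 0)] else if i = 1 then [(1, 0), (0, 1)]
                 else if i = 2 then [(1, 1)] else []),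
     coef = (\<lambda>i r c. if i = 1 then (if c = 0 then polyX else polyY)
                     else if i = 2 then (if r = 0 then - polyY else polyX) else 0) \<rparr>"

lemma lookup_monom_mult:
  fixes p :: "'k::field bipoly"
  shows "Poly_Mapping.lookup (monom2 m 1 * p) n =
    (if fst m \<le> fst n \<and> snd m \<le> snd n
     then Poly_Mapping.lookup p (fst n - fst m, snd n - snd m) else 0)"
proof -
  have "Poly_Mapping.lookup (monom2 m 1 * p) n
      = (\<Sum>l. (1 when m = l) * (\<Sum>q. (Poly_Mapping.lookup p q when n = l + q)))"
    by (simp add: lookup_mult lookup_single)
  also have "\<dots> = (\<Sum>q. (Poly_Mapping.lookup p q when n = m + q))"
    by (simp add: when_mult)
  also have "\<dots> = (\<Sum>q. (if fst m \<le> fst n \<and> snd m \<le> snd n then Poly_Mapping.lookup p q else 0)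
                       when q = (fst n - fst m, snd n - snd m))"
    by (rule Sum_any.cong) (auto simp: when_def prod_eq_iff)
  finally show ?thesis by simp
qed

lemma koszul_resolution: "residue_field_resolution (koszul :: 'k::field free_complex)"
proof -
  let ?K = "koszul :: 'k free_complex"
  have d0: "degs ?K 0 = [(0, 0)]" and d1: "degs ?K (Suc 0) = [(1, 0), (0, 1)]"
    and d2: "degs ?K 2 = [(1, 1)]" and d3: "\<And>i. i > 2 \<Longrightarrow> degs ?K i = []"
    by (simp_all add: koszul_def)
  have two: "Suc (Suc 0) = 2" by simp
  have lx: "Poly_Mapping.lookup (polyX * p) (i, j)
      = (if i = 0 then 0 else Poly_Mapping.lookup p (i - 1, j))" for p :: "'k bipoly" and i j
    by (simp add: lookup_monom_mult)
  have ly: "Poly_Mapping.lookup (polyY * p) (i, j)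
      = (if j = 0 then 0 else Poly_Mapping.lookup p (i, j - 1))" for p :: "'k bipoly" and i j
    by (simp add: lookup_monom_mult)
  define dx :: "'k bipoly \<Rightarrow> 'k bipoly" where "dx = Poly_Mapping.map_key (\<lambda>n. n + (1, 0))"
  define dy :: "'k bipoly \<Rightarrow> 'k bipoly" where "dy = Poly_Mapping.map_key (\<lambda>n. n + (0, 1))"
  have ldx: "Poly_Mapping.lookup (dx p) (i, j) = Poly_Mapping.lookup p (Suc i, j)" for p i j
    unfolding dx_def by (subst map_key.rep_eq) (auto intro: injI)
  have ldy: "Poly_Mapping.lookup (dy p) (i, j) = Poly_Mapping.lookup p (i, Suc j)" for p i j
    unfolding dy_def by (subst map_key.rep_eq) (auto intro: injI)
  have b1: "bd (*) ?K (Suc 0) u = (\<lambda>r. if r = 0 then polyX * u 0 + polyY * u 1 else 0)" for u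
    by (auto simp: bd_def d0 d1 fun_eq_iff) (simp add: koszul_def)
  have b2: "bd (*) ?K 2 u = (\<lambda>r. if r = 0 then - polyY * u 0 else if r = 1 then polyX * u 0 else 0)" for u
    by (auto simp: bd_def d1 d2 fun_eq_iff less_Suc_eq) (simp_all add: koszul_def)
  have b3: "bd (*) ?K i u = 0" if "i > 2" for i u
    using that by (auto simp: bd_def d3 fun_eq_iff)
  have hom: "homogeneous (degs ?K i ! c - degs ?K (i - 1) ! r) (coef ?K i r c)"
    if "0 < i" "r < rk ?K (i - 1)" "c < rk ?K i" for i r c
  proof -
    consider "i = 1" | "i = 2" | "i > 2" using \<open>0 < i\<close> by linarith
    then show ?thesis
      using that by cases (auto simp: koszul_def homogeneous_def bideg_of_def lookup_single
          when_def less_Suc_eq zero_prod_def split: if_splits)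
  qed
  have im1: "bd (*) ?K 1 ` free_chains ?K 1 = {u \<in> free_chains ?K 0. Poly_Mapping.lookup (u 0) 0 = 0}"
  proof (intro equalityI subsetI)
    fix u assume "u \<in> bd (*) ?K 1 ` free_chains ?K 1"
    then show "u \<in> {u \<in> free_chains ?K 0. Poly_Mapping.lookup (u 0) 0 = 0}"
      by (auto simp: b1 free_chains_def d0 lookup_add lookup_monom_mult)
  next
    fix u :: "nat \<Rightarrow> 'k bipoly"
    assume u: "u \<in> {u \<in> free_chains ?K 0. Poly_Mapping.lookup (u 0) 0 = 0}"
    define a where "a = dx (u 0)"
    define b where "b = dy (u 0 - polyX * a)"
    have "Poly_Mapping.lookup (polyX * a + polyY * b) (i, j) = Poly_Mapping.lookup (u 0) (i, j)" for i j
      using u by (cases i; cases j)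
        (auto simp: lookup_add lookup_minus lookup_monom_mult a_def b_def ldx ldy zero_prod_def)
    then have "polyX * a + polyY * b = u 0"
      by (intro poly_mapping_eqI) auto
    then have "u = bd (*) ?K 1 (\<lambda>c. if c = 0 then a else if c = 1 then b else 0)"
      using u by (auto simp: b1 free_chains_def d0 fun_eq_iff)
    moreover have "(\<lambda>c. if c = 0 then a else if c = 1 then b else 0) \<in> free_chains ?K 1"
      by (auto simp: free_chains_def d1)
    ultimately show "u \<in> bd (*) ?K 1 ` free_chains ?K 1" by blast
  qed
  have ex: "{u \<in> free_chains ?K i. bd (*) ?K i u = 0} = bd (*) ?K (Suc i) ` free_chains ?K (Suc i)"
    if "i > 0" for i
  proof -
    consider "i = 1" | "i = 2" | "i > 2" using \<open>0 < i\<close> by linarith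
    then show ?thesis
    proof cases
      case 1
      show ?thesis
      proof (intro equalityI subsetI)
        fix u assume "u \<in> {u \<in> free_chains ?K i. bd (*) ?K i u = 0}"
        then have u: "\<And>c. 2 \<le> c \<Longrightarrow> u c = 0" and z': "bd (*) ?K (Suc 0) u = 0"
          using 1 by (auto simp: free_chains_def d1)
        have z: "polyX * u 0 + polyY * u 1 = 0"
          using fun_cong[OF z', of 0] by (simp add: b1)
        have c: "(if i = 0 then 0 else Poly_Mapping.lookup (u 0) (i - 1, j))
            + (if j = 0 then 0 else Poly_Mapping.lookup (u 1) (i, j - 1)) = 0" for i j
          using arg_cong[OF z, of "\<lambda>p. Poly_Mapping.lookup p (i, j)"]
          by (simp only: lookup_add lx ly lookup_zero)
        define w where "w = dx (u 1)"
        have "Poly_Mapping.lookup (polyX * w) (i, j) = Poly_Mapping.lookup (u 1) (i, j)" for i j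
          using c[of 0 "Suc j"] by (cases i) (auto simp: lookup_monom_mult w_def ldx)
        then have 1: "polyX * w = u 1" by (intro poly_mapping_eqI) auto
        have "Poly_Mapping.lookup (- (polyY * w)) (i, j) = Poly_Mapping.lookup (u 0) (i, j)" for i j
          using c[of "Suc i" 0] c[of "Suc i" j]
          by (cases j) (auto simp: lookup_monom_mult w_def ldx lookup_uminus eq_neg_iff_add_eq_0 neg_eq_iff_add_eq_0 add.commute)
        then have 2: "- (polyY * w) = u 0" by (intro poly_mapping_eqI) auto
        have "u = bd (*) ?K 2 (\<lambda>c. if c = 0 then w else 0)"
          using 1 2 u by (auto simp: b2 fun_eq_iff)
        moreover have "(\<lambda>c. if c = 0 then w else 0) \<in> free_chains ?K 2"
          by (auto simp: free_chains_def d2)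
        ultimately show "u \<in> bd (*) ?K (Suc i) ` free_chains ?K (Suc i)"
          using \<open>i = 1\<close> by (auto simp: two)
      next
        fix u assume "u \<in> bd (*) ?K (Suc i) ` free_chains ?K (Suc i)"
        then show "u \<in> {u \<in> free_chains ?K i. bd (*) ?K i u = 0}"
          using 1 by (auto simp: two b1 b2 free_chains_def d1 fun_eq_iff algebra_simps)
      qed
    next
      case 2
      have "u = 0" if u: "u \<in> free_chains ?K 2" and z: "bd (*) ?K 2 u = 0" for u
      proof -
        have xu: "polyX * u 0 = 0" using fun_cong[OF z, of 1] by (simp add: b2)
        have "Poly_Mapping.lookup (u 0) (i, j) = 0" for i j
          using arg_cong[OF xu, of "\<lambda>p. Poly_Mapping.lookup p (Suc i, j)"] by (simp add: lookup_monom_mult)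
        then have "u 0 = 0" by (intro poly_mapping_eqI) auto
        then show "u = 0"
          using u by (auto simp: free_chains_def d2 fun_eq_iff) (metis One_nat_def Suc_leI neq0_conv)
      qed
      moreover have "bd (*) ?K 2 0 = 0" "0 \<in> free_chains ?K 2" "(\<lambda>c. 0) \<in> free_chains ?K 3"
        by (auto simp: b2 free_chains_def fun_eq_iff)
      ultimately show ?thesis using 2 by (auto simp: b3 image_iff)
    next
      case 3
      then show ?thesis by (auto simp: b3 free_chains_def d3 fun_eq_iff image_iff)
    qed
  qed
  show ?thesis
    unfolding residue_field_resolution_def using hom d0 im1 ex by blast
qed


section \<open>Betti tables\<close>

text \<open>\<open>betti s G i \<alpha>\<close> is the \<open>k\<close>-dimension of \<open>Tor_i(M, k)\<close> in bidegree \<open>\<alpha>\<close>: by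
  \<open>koszul_resolution\<close>, \<open>Tor(M, k)\<close> is the homology of \<open>M \<otimes> koszul\<close>. It vanishes for \<open>i > 2\<close>.
  The truncated subtraction in \<^const>\<open>homology_dim\<close> is harmless, since the graded components of a
  module of finite length are finite-dimensional.\<close>

definition betti ::
  "('k::field bipoly \<Rightarrow> 'm::ab_group_add \<Rightarrow> 'm) \<Rightarrow> (bideg \<Rightarrow> 'm set) \<Rightarrow> nat \<Rightarrow> bideg \<Rightarrow> nat" where
  "betti s G i \<alpha> = homology_dim s G koszul i \<alpha>"

definition betti_table ::
  "('k::field bipoly \<Rightarrow> 'm::ab_group_add \<Rightarrow> 'm) \<Rightarrow> (bideg \<Rightarrow> 'm set) \<Rightarrow> nat \<Rightarrow> bideg \<Rightarrow> rat" where
  "betti_table s G = (\<lambda>i \<alpha>. if i \<le> 2 then of_nat (betti s G i \<alpha>) else 0)"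

text \<open>Betti tables are tables of modules of finite length, so the summands \<open>M'\<close> and \<open>M''\<close> are
  bigraded modules of finite length. HOL cannot quantify over the types of their elements inside a
  formula; these types are parameters, to be left as free type variables in theorems.\<close>

definition extremal ::
  "'a::ab_group_add itself \<Rightarrow> 'b::ab_group_add itself
     \<Rightarrow> ('k::field bipoly \<Rightarrow> 'm::ab_group_add \<Rightarrow> 'm) \<Rightarrow> (bideg \<Rightarrow> 'm set) \<Rightarrow> bool" where
  "extremal _ _ s G \<longleftrightarrow>
     (\<forall>(s' :: 'k bipoly \<Rightarrow> 'a \<Rightarrow> 'a) G' (s'' :: 'k bipoly \<Rightarrow> 'b \<Rightarrow> 'b) G''.
        bigraded_module s' G' \<and> finite_length s' \<and>
        bigraded_module s'' G'' \<and> finite_length s'' \<and>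
        betti_table s G = betti_table s' G' + betti_table s'' G'' \<longrightarrow>
        (\<exists>q::rat. betti_table s' G' = (\<lambda>i \<alpha>. q * betti_table s G i \<alpha>)))"


section \<open>Matching graphs\<close>

record 'v matching_graph =
  verts :: "'v set"
  weight :: "'v \<Rightarrow> int"
  x_edges :: "'v set set"
  y_edges :: "'v set set"

definition matching_graph ::
  "('k::field bipoly \<Rightarrow> 'm::ab_group_add \<Rightarrow> 'm) \<Rightarrow> (bideg \<Rightarrow> 'm set) \<Rightarrow> bideg matching_graph" where
  "matching_graph s G = (let V = {\<alpha>. \<exists>i\<in>{0,1,2}. betti s G i \<alpha> \<noteq> 0} in
     \<lparr> verts = V,
       weight = (\<lambda>\<alpha>. int (betti s G 0 \<alpha> + betti s G 1 \<alpha> + betti s G 2 \<alpha>)),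
       x_edges = {{\<alpha>, \<beta>} | \<alpha> \<beta>. \<alpha> \<in> V \<and> \<beta> \<in> V \<and> \<alpha> \<noteq> \<beta> \<and> fst \<alpha> = fst \<beta>},
       y_edges = {{\<alpha>, \<beta>} | \<alpha> \<beta>. \<alpha> \<in> V \<and> \<beta> \<in> V \<and> \<alpha> \<noteq> \<beta> \<and> snd \<alpha> = snd \<beta>} \<rparr>)"

definition has_valency :: "'v matching_graph \<Rightarrow> 'v \<Rightarrow> nat \<times> nat \<Rightarrow> bool" where
  "has_valency \<Gamma> v ab \<longleftrightarrow>
     finite {e \<in> x_edges \<Gamma>. v \<in> e} \<and> card {e \<in> x_edges \<Gamma>. v \<in> e} = fst ab \<and>
     finite {e \<in> y_edges \<Gamma>. v \<in> e} \<and> card {e \<in> y_edges \<Gamma>. v \<in> e} = snd ab"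

definition valent :: "nat \<times> nat \<Rightarrow> 'v matching_graph \<Rightarrow> bool" where
  "valent ab \<Gamma> \<longleftrightarrow> (\<forall>v\<in>verts \<Gamma>. has_valency \<Gamma> v ab)"

definition graph_connected :: "'v matching_graph \<Rightarrow> bool" where
  "graph_connected \<Gamma> \<longleftrightarrow>
     (\<forall>u\<in>verts \<Gamma>. \<forall>v\<in>verts \<Gamma>. (u, v) \<in> {(a, b). {a, b} \<in> x_edges \<Gamma> \<union> y_edges \<Gamma>}\<^sup>*)"

end

theory Submission
  imports Defs
begin

text \<open>Write \<open>\<chi>(\<alpha>) = \<beta>_0(\<alpha>) - \<beta>_1(\<alpha>) + \<beta>_2(\<alpha>)\<close>. This is a second mixed difference of the Hilbert
  function, so for every bigraded module of finite length the values of \<open>\<chi>\<close> in a column, or in a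
  row, add up to zero (\<open>euler_column\<close>, \<open>euler_row\<close>). If \<open>\<Gamma>(M)\<close> is \<open>(1,1)\<close>-valent, a column that
  contains a vertex contains exactly two, and hence \<open>\<chi>\<close> changes sign along every edge. In a
  decomposition \<open>\<beta>(M) = \<beta>(M') + \<beta>(M'')\<close> the table of \<open>M'\<close> is supported where that of \<open>M\<close> is, so
  the same holds for \<open>\<chi>'\<close>, the alternating sum for \<open>M'\<close>, along the edges of \<open>\<Gamma>(M)\<close>. As the graph
  is connected, \<open>\<chi>'\<close> is a scalar multiple of \<open>\<chi>\<close>.

  This determines the Betti tables only if no vertex of \<open>\<Gamma>(M)\<close> carries two homological degrees,
  since then, up to sign, \<open>\<chi>(\<alpha>)\<close> is the only nonzero Betti number at \<open>\<alpha>\<close>. That this is the case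
  is the main point (\<open>homological_degree_unique\<close>). It uses more than Euler characteristics: in each
  column, every generator of \<open>M\<close> has a first syzygy above it, every second syzygy has a first
  syzygy below it, and a first syzygy has a generator below or a second syzygy above it; likewise
  in rows (\<open>column_law_tor\<close>, \<open>row_law_tor\<close>). With only two vertices in each column and row, a
  vertex with two homological degrees would then force another one of larger \<open>y\<close>-degree, and so
  on without end.\<close>

section \<open>Dimension of finite-dimensional subspaces\<close>

context vector_space
begin

definition fin_dim :: "'b set \<Rightarrow> bool" where
  "fin_dim S \<longleftrightarrow> (\<exists>B. finite B \<and> S \<subseteq> span B)"

lemma fin_dim_subset: "fin_dim S \<Longrightarrow> U \<subseteq> S \<Longrightarrow> fin_dim U"
  unfolding fin_dim_def by blast

lemma nested_bases:
  assumes "subspace U" "subspace S" "U \<subseteq> S" "fin_dim S"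
  obtains B C where "B \<subseteq> C" "finite C" "independent C" "span B = U" "span C = S"
proof -
  obtain B where B: "B \<subseteq> U" "independent B" "U \<subseteq> span B"
    using maximal_independent_subset by blast
  obtain C where C: "B \<subseteq> C" "C \<subseteq> S" "independent C" "S \<subseteq> span C"
    using maximal_independent_subset_extend[of B S] B \<open>U \<subseteq> S\<close> by blast
  obtain D where "finite D" "S \<subseteq> span D" using \<open>fin_dim S\<close> by (auto simp: fin_dim_def)
  then have "finite C" using independent_span_bound[of D C] C by blast
  moreover have "span B = U" by (rule span_subspace[OF B(1,3) assms(1)])
  moreover have "span C = S" by (rule span_subspace[OF C(2,4) assms(2)])
  ultimately show ?thesis using that C by blast
qed

lemma dim_subspace_le:
  assumes "subspace U" "subspace S" "U \<subseteq> S" "fin_dim S"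
  shows "dim U \<le> dim S"
  using nested_bases[OF assms]
  by (metis card_mono dim_span_eq_card_independent independent_mono)

lemma dim_subspace_eq:
  assumes "subspace U" "subspace S" "U \<subseteq> S" "fin_dim S" "dim U = dim S"
  shows "U = S"
  using nested_bases[OF assms(1-4)] assms(5)
  by (metis card_subset_eq dim_span_eq_card_independent independent_mono)

lemma dim_zero_subspace: "dim {0} = 0"
  using dim_span_eq_card_independent[OF independent_empty] by simp

text \<open>In a chain of submodules built from a \<open>k\<close>-subspace, finite length bounds the number of
  independent vectors; this turns that bound into finite dimension.\<close>

lemma fin_dim_if_independent_bounded:
  assumes "\<And>B. finite B \<Longrightarrow> B \<subseteq> S \<Longrightarrow> independent B \<Longrightarrow> card B \<le> N"
  shows "fin_dim S"
proof -
  obtain B where B: "B \<subseteq> S" "independent B" "S \<subseteq> span B"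
    using maximal_independent_subset by blast
  have "finite B"
  proof (rule ccontr)
    assume "infinite B"
    then obtain C where "C \<subseteq> B" "finite C" "card C = Suc N"
      using infinite_arbitrarily_large by blast
    then show False using assms[of C] B independent_mono by fastforce
  qed
  then show ?thesis using B by (auto simp: fin_dim_def)
qed

end

context linear
begin

lemma fin_dim_image: "vs1.fin_dim S \<Longrightarrow> vs2.fin_dim (f ` S)"
  unfolding vs1.fin_dim_def vs2.fin_dim_def by (metis finite_imageI spans_image)

text \<open>A basis of the kernel of \<open>f\<close> on \<open>S\<close> extends to a basis of \<open>S\<close>, and \<open>f\<close> maps the added
  vectors to a basis of \<open>f ` S\<close>.\<close>

lemma rank_nullity:
  assumes "vs1.subspace S" "vs1.fin_dim S"
  shows "vs1.dim S = vs1.dim {u \<in> S. f u = 0} + vs2.dim (f ` S)"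
proof -
  let ?K = "{u \<in> S. f u = 0}"
  have "vs1.subspace (S \<inter> {u. f u = 0})"
    by (intro vs1.subspace_inter assms subspace_kernel)
  then have K: "vs1.subspace ?K" by (simp add: Int_def)
  obtain B C where BC: "B \<subseteq> C" "finite C" "vs1.independent C" "vs1.span B = ?K" "vs1.span C = S"
    using vs1.nested_bases[OF K assms(1) _ assms(2)] by blast
  let ?D = "C - B"
  have CD: "C = B \<union> ?D" using BC by blast
  have inj: "inj_on f (vs1.span ?D)"
  proof (subst inj_on_iff_eq_0)
    show "\<forall>x\<in>vs1.span ?D. f x = 0 \<longrightarrow> x = 0"
    proof (intro ballI impI)
      fix x assume x: "x \<in> vs1.span ?D" "f x = 0"
      have "x \<in> S" using x BC vs1.span_mono[of ?D C] by blast
      then have "x \<in> vs1.span B" using BC x by auto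
      have "vs1.representation C x = vs1.representation B x"
        by (rule vs1.representation_extend) (use BC \<open>x \<in> vs1.span B\<close> in auto)
      moreover have "vs1.representation C x = vs1.representation ?D x"
        by (rule vs1.representation_extend) (use BC x in auto)
      moreover have "vs1.representation B x b = 0 \<or> vs1.representation ?D x b = 0" for b
        using vs1.representation_ne_zero[of B x b] vs1.representation_ne_zero[of ?D x b] by blast
      ultimately have "vs1.representation C x b = 0" for b by metis
      then show "x = 0"
        using vs1.sum_nonzero_representation_eq[OF BC(3), of x] \<open>x \<in> S\<close> BC(5) by simp
    qed
  qed auto
  have ind: "vs1.independent ?D" using BC vs1.independent_mono by blast
  have indf: "vs2.independent (f ` ?D)"
    by (rule independent_injective_image[OF ind inj])
  have cardf: "card (f ` ?D) = card ?D"
    by (rule card_image) (use inj vs1.span_superset inj_on_subset in blast)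
  have "f ` S = vs2.span (f ` C)" using span_image BC by simp
  also have "\<dots> = vs2.span (f ` ?D)"
  proof
    have "f ` C \<subseteq> insert 0 (f ` ?D)"
      using BC(4) vs1.span_superset[of B] by fastforce
    then show "vs2.span (f ` C) \<subseteq> vs2.span (f ` ?D)"
      using vs2.span_mono vs2.span_insert_0 by metis
    show "vs2.span (f ` ?D) \<subseteq> vs2.span (f ` C)" by (intro vs2.span_mono) auto
  qed
  finally have "vs2.dim (f ` S) = card ?D"
    using vs2.dim_span_eq_card_independent[OF indf] cardf by simp
  moreover have "vs1.dim ?K = card B" "vs1.dim S = card C"
    using BC vs1.dim_span_eq_card_independent vs1.independent_mono by metis+
  moreover have "card C = card B + card ?D"
    using BC by (metis card_Diff_subset card_mono finite_subset le_add_diff_inverse)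
  ultimately show ?thesis by simp
qed

lemma dim_injective_image:
  assumes "vs1.subspace S" "vs1.fin_dim S" "\<And>u. u \<in> S \<Longrightarrow> f u = 0 \<Longrightarrow> u = 0"
  shows "vs2.dim (f ` S) = vs1.dim S"
proof -
  have "{u \<in> S. f u = 0} = {0}" using assms vs1.subspace_0 by auto
  then show ?thesis using rank_nullity[OF assms(1,2)] vs1.dim_zero_subspace by simp
qed

end

section \<open>Homological degrees in a matching graph\<close>

text \<open>The Betti numbers in the column of \<open>x\<close>-degree \<open>a\<close> are those of two graded
  \<open>k[y]\<close>-modules of finite length, namely the cokernel of \<open>x\<close> into column \<open>a\<close> (generators in
  \<open>t0\<close>, relations in \<open>t1\<close>) and the kernel of \<open>x\<close> on column \<open>a - 1\<close> (generators in \<open>t1\<close>,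
  relations in \<open>t2\<close>). Each of these is a direct sum of truncations \<open>k[y]/(y^n)\<close>, so every
  generator has a relation above it and every relation a generator below it. The property
  keeps just this much.\<close>

definition column_law ::
  "(int \<Rightarrow> int \<Rightarrow> bool) \<Rightarrow> (int \<Rightarrow> int \<Rightarrow> bool) \<Rightarrow> (int \<Rightarrow> int \<Rightarrow> bool) \<Rightarrow> bool" where
  "column_law t0 t1 t2 \<longleftrightarrow> (\<forall>a b.
     (t0 a b \<longrightarrow> (\<exists>b'>b. t1 a b')) \<and>
     (t2 a b \<longrightarrow> (\<exists>b'<b. t1 a b')) \<and>
     (t1 a b \<longrightarrow> (\<exists>b'<b. t0 a b') \<or> (\<exists>b'>b. t2 a b')))"

lemma column_lawD:
  assumes "column_law t0 t1 t2"
  shows "t0 a b \<Longrightarrow> \<exists>b'>b. t1 a b'" "t2 a b \<Longrightarrow> \<exists>b'<b. t1 a b'"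
    "t1 a b \<Longrightarrow> (\<exists>b'<b. t0 a b') \<or> (\<exists>b'>b. t2 a b')"
  using assms unfolding column_law_def by blast+

text \<open>Suppose a vertex carries two homological degrees. It cannot carry 0 and 2, since then it
  would have a neighbour above and one below in its column. If it carries 0 and 1, then its
  neighbour in the column lies above it and carries 1 and 2; in turn the neighbour of that
  vertex in its row lies to the left and carries 0 and 1 again. Repeating this produces such
  vertices of ever larger \<open>y\<close>-degree, against the bound \<open>N\<close>.\<close>

lemma homological_degree_unique:
  fixes t0 t1 t2 :: "int \<Rightarrow> int \<Rightarrow> bool"
  defines "V \<equiv> \<lambda>a b. t0 a b \<or> t1 a b \<or> t2 a b"
  assumes col: "column_law t0 t1 t2"
    and row: "column_law (\<lambda>b a. t0 a b) (\<lambda>b a. t1 a b) (\<lambda>b a. t2 a b)"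
    and ucol: "\<And>a b b' b''. V a b \<Longrightarrow> V a b' \<Longrightarrow> V a b'' \<Longrightarrow> b' \<noteq> b \<Longrightarrow> b'' \<noteq> b \<Longrightarrow> b' = b''"
    and urow: "\<And>a a' a'' b. V a b \<Longrightarrow> V a' b \<Longrightarrow> V a'' b \<Longrightarrow> a' \<noteq> a \<Longrightarrow> a'' \<noteq> a \<Longrightarrow> a' = a''"
    and bound: "\<And>a b. V a b \<Longrightarrow> b \<le> N"
  shows "\<not> (t0 a b \<and> t1 a b)" "\<not> (t1 a b \<and> t2 a b)" "\<not> (t0 a b \<and> t2 a b)"
proof -
  note C = column_lawD[OF col] and R = column_lawD[OF row]
  have V: "V a b" if "t0 a b \<or> t1 a b \<or> t2 a b" for a b using that by (simp add: V_def)
  have 1: "\<exists>b'>b. t1 a b' \<and> t2 a b'" if h: "t0 a b" "t1 a b" for a b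
  proof -
    obtain b' where b': "b' > b" "t1 a b'" using C(1) h by blast
    have "\<not> t0 a b''" if "b'' < b" for b''
      using ucol[of a b b' b''] V b' h that by fastforce
    then obtain b'' where "b'' > b" "t2 a b''" using C(3) h by blast
    then show ?thesis using ucol[of a b b' b''] V b' h by fastforce
  qed
  have 2: "\<exists>a'<a. t0 a' b \<and> t1 a' b" if h: "t1 a b" "t2 a b" for a b
  proof -
    obtain a' where a': "a' < a" "t1 a' b" using R(2) h by blast
    have "\<not> t2 a'' b" if "a'' > a" for a''
      using urow[of a b a' a''] V a' h that by fastforce
    then obtain a'' where "a'' < a" "t0 a'' b" using R(3) h by blast
    then show ?thesis using urow[of a b a' a''] V a' h by fastforce
  qed
  have 3: "\<not> (t0 a b \<and> t1 a b)" for a b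
  proof (induction "nat (N - b)" arbitrary: a b rule: less_induct)
    case less
    show ?case
    proof
      assume "t0 a b \<and> t1 a b"
      then obtain b' a' where "b' > b" "t0 a' b'" "t1 a' b'" using 1 2 by blast
      then show False using less[of b' a'] bound[of a' b'] V by fastforce
    qed
  qed
  then show "\<not> (t0 a b \<and> t1 a b)" "\<not> (t1 a b \<and> t2 a b)" using 2 by blast+
  show "\<not> (t0 a b \<and> t2 a b)"
  proof
    assume h: "t0 a b \<and> t2 a b"
    obtain b' b'' where "b' > b" "t1 a b'" "b'' < b" "t1 a b''" using C(1,2) h by blast
    then show False using ucol[of a b b' b''] V h by fastforce
  qed
qed

section \<open>Two commuting operators\<close>

text \<open>All that the nonvanishing of \<open>Tor\<close> needs of a bigraded module of finite length is the two
  commuting operators, multiplication by \<open>x\<close> and by \<open>y\<close>. In this form rows and columns are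
  exchanged by exchanging \<open>X\<close> and \<open>Y\<close>.\<close>

locale bigraded_pair =
  fixes X Y :: "'m::ab_group_add \<Rightarrow> 'm" and G :: "int \<Rightarrow> int \<Rightarrow> 'm set" and N :: int
  assumes X_add: "X (u + v) = X u + X v" and Y_add: "Y (u + v) = Y u + Y v"
    and XY: "X (Y u) = Y (X u)"
    and G0: "0 \<in> G a b" and G_add: "u \<in> G a b \<Longrightarrow> v \<in> G a b \<Longrightarrow> u + v \<in> G a b"
    and G_minus: "u \<in> G a b \<Longrightarrow> - u \<in> G a b"
    and G_X: "u \<in> G (a - 1) b \<Longrightarrow> X u \<in> G a b" and G_Y: "u \<in> G a (b - 1) \<Longrightarrow> Y u \<in> G a b"
    and bounded: "u \<in> G a b \<Longrightarrow> u \<noteq> 0 \<Longrightarrow> \<bar>a\<bar> \<le> N \<and> \<bar>b\<bar> \<le> N"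
begin

text \<open>The homology of the Koszul complex of \<open>X\<close> and \<open>Y\<close> is nonzero in homological degrees 0, 1, 2.\<close>

definition tor0 :: "int \<Rightarrow> int \<Rightarrow> bool" where
  "tor0 a b \<longleftrightarrow> (\<exists>u\<in>G a b. \<forall>v\<in>G (a - 1) b. \<forall>w\<in>G a (b - 1). u \<noteq> X v + Y w)"

definition tor1 :: "int \<Rightarrow> int \<Rightarrow> bool" where
  "tor1 a b \<longleftrightarrow> (\<exists>u\<in>G (a - 1) b. \<exists>v\<in>G a (b - 1). X u + Y v = 0 \<and>
     (\<forall>w\<in>G (a - 1) (b - 1). u = - Y w \<longrightarrow> v \<noteq> X w))"

definition tor2 :: "int \<Rightarrow> int \<Rightarrow> bool" where
  "tor2 a b \<longleftrightarrow> (\<exists>u\<in>G (a - 1) (b - 1). u \<noteq> 0 \<and> X u = 0 \<and> Y u = 0)"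

lemma X0 [simp]: "X 0 = 0" and Y0 [simp]: "Y 0 = 0"
  using X_add[of 0 0] Y_add[of 0 0] by simp_all

lemma X_minus: "X (- u) = - X u" and Y_minus: "Y (- u) = - Y u"
  using X_add[of u "- u"] Y_add[of u "- u"] by (simp_all add: eq_neg_iff_add_eq_0 add.commute)

text \<open>The next four lemmas climb up or down along \<open>Y\<close>, which ends because the degrees are bounded.
  Here \<open>u\<close> is a nonzero element of the cokernel of \<open>X\<close>; its last multiple by a power
  of \<open>Y\<close> is killed by \<open>Y\<close> and gives a relation.\<close>

lemma tor1_if_not_image:
  assumes "u \<in> G a b" "u \<notin> X ` G (a - 1) b"
  shows "\<exists>b'>b. tor1 a b'"
  using assms
proof (induction "nat (N + 1 - b)" arbitrary: b u rule: less_induct)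
  case less
  have "u \<noteq> 0" using less.prems G0[of "a - 1" b] by force
  then have "b \<le> N" using bounded less.prems by fastforce
  show ?case
  proof (cases "Y u \<in> X ` G (a - 1) (b + 1)")
    case True
    then obtain v where v: "v \<in> G (a - 1) (b + 1)" "Y u = X v" by blast
    have "X (- v) + Y u = 0" using v by (simp add: X_minus)
    then have "tor1 a (b + 1)"
      unfolding tor1_def using v less.prems G_minus[of v] by (intro bexI[of _ "-v"] bexI[of _ u]) auto
    then show ?thesis by force
  next
    case False
    moreover have "Y u \<in> G a (b + 1)" using G_Y[of u a "b + 1"] less.prems by simp
    ultimately obtain b' where "b' > b + 1" "tor1 a b'"
      using less.hyps[of "b + 1" "Y u"] \<open>b \<le> N\<close> by auto
    then show ?thesis by force
  qed
qed

text \<open>Dividing an element of the cokernel of \<open>X\<close> by \<open>Y\<close> as often as possible ends in a generator.\<close>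

lemma tor0_if_not_image:
  assumes "u \<in> G a b" "u \<notin> X ` G (a - 1) b"
  shows "\<exists>b'\<le>b. tor0 a b'"
  using assms
proof (induction "nat (b + N + 1)" arbitrary: b u rule: less_induct)
  case less
  have "u \<noteq> 0" using less.prems G0[of "a - 1" b] by force
  then have b: "- N \<le> b" using bounded less.prems by fastforce
  show ?case
  proof (cases "tor0 a b")
    case False
    then obtain v w where vw: "v \<in> G (a - 1) b" "w \<in> G a (b - 1)" "u = X v + Y w"
      using less.prems unfolding tor0_def by blast
    have "w \<notin> X ` G (a - 1) (b - 1)"
    proof
      assume "w \<in> X ` G (a - 1) (b - 1)"
      then obtain w' where w': "w' \<in> G (a - 1) (b - 1)" "w = X w'" by blast
      then have "u = X (v + Y w')" using vw by (simp add: X_add XY)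
      then show False using less.prems vw G_add G_Y[OF w'(1)] by blast
    qed
    then obtain b' where "b' \<le> b - 1" "tor0 a b'"
      using less.hyps[of "b - 1" w] vw b by auto
    then show ?thesis by (intro exI[of _ b']) simp
  qed auto
qed

text \<open>The last nonzero multiple of \<open>u\<close> by a power of \<open>Y\<close> is in the socle.\<close>

lemma tor2_if_kernel:
  assumes "u \<in> G (a - 1) b" "X u = 0" "u \<noteq> 0"
  shows "\<exists>b'>b. tor2 a b'"
  using assms
proof (induction "nat (N + 1 - b)" arbitrary: b u rule: less_induct)
  case less
  have b: "b \<le> N" using bounded less.prems by fastforce
  show ?case
  proof (cases "Y u = 0")
    case True
    then have "tor2 a (b + 1)" unfolding tor2_def using less.prems by auto
    then show ?thesis by force
  next
    case False
    moreover have "Y u \<in> G (a - 1) (b + 1)" using G_Y[of u "a - 1" "b + 1"] less.prems by simp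
    ultimately obtain b' where "b' > b + 1" "tor2 a b'"
      using less.hyps[of "b + 1" "Y u"] b less.prems XY[of u] by auto
    then show ?thesis by force
  qed
qed

text \<open>Dividing \<open>u\<close> by \<open>Y\<close> within the kernel of \<open>X\<close> as often as possible ends in a generator of
  this kernel, hence in a cycle that is no boundary.\<close>

lemma tor1_if_kernel:
  assumes "u \<in> G (a - 1) b" "X u = 0" "u \<noteq> 0"
  shows "\<exists>b'\<le>b. tor1 a b'"
  using assms
proof (induction "nat (b + N + 1)" arbitrary: b u rule: less_induct)
  case less
  have b: "- N \<le> b" using bounded less.prems by fastforce
  show ?case
  proof (cases "\<exists>w\<in>G (a - 1) (b - 1). u = - Y w \<and> X w = 0")
    case True
    then obtain w where w: "w \<in> G (a - 1) (b - 1)" "u = - Y w" "X w = 0" by blast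
    then have "w \<noteq> 0" using less.prems by auto
    then obtain b' where "b' \<le> b - 1" "tor1 a b'"
      using less.hyps[of "b - 1" w] w b by auto
    then show ?thesis by (intro exI[of _ b']) simp
  next
    case False
    then have "tor1 a b"
      unfolding tor1_def using less.prems G0 by (intro bexI[of _ u] bexI[of _ 0]) auto
    then show ?thesis by blast
  qed
qed

text \<open>For a cycle \<open>(u, v)\<close> that is no boundary, either \<open>v\<close> is nonzero in the cokernel of \<open>X\<close>, or
  a boundary can be subtracted to make \<open>v\<close> zero, and what remains of \<open>u\<close> is a nonzero element
  of the kernel of \<open>X\<close>.\<close>

lemma column_law_tor: "column_law tor0 tor1 tor2"
  unfolding column_law_def
proof (intro allI conjI impI)
  fix a b
  show "\<exists>b'>b. tor1 a b'" if t: "tor0 a b"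
  proof -
    obtain u where u: "u \<in> G a b" "\<forall>v\<in>G (a - 1) b. \<forall>w\<in>G a (b - 1). u \<noteq> X v + Y w"
      using t unfolding tor0_def by blast
    then have "u \<notin> X ` G (a - 1) b" using G0[of a "b - 1"] by force
    then show ?thesis using tor1_if_not_image u by blast
  qed
  show "\<exists>b'<b. tor1 a b'" if t: "tor2 a b"
    using t tor1_if_kernel[of _ a "b - 1"] unfolding tor2_def by fastforce
  show "(\<exists>b'<b. tor0 a b') \<or> (\<exists>b'>b. tor2 a b')" if t: "tor1 a b"
  proof -
    obtain u v where uv: "u \<in> G (a - 1) b" "v \<in> G a (b - 1)" "X u + Y v = 0"
      and nb: "\<And>w. w \<in> G (a - 1) (b - 1) \<Longrightarrow> u = - Y w \<Longrightarrow> v \<noteq> X w"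
      using t unfolding tor1_def by blast
    show ?thesis
    proof (cases "v \<in> X ` G (a - 1) (b - 1)")
      case True
      then obtain w where w: "w \<in> G (a - 1) (b - 1)" "v = X w" by blast
      have "u + Y w \<in> G (a - 1) b" using uv w G_add G_Y by blast
      moreover have "X (u + Y w) = 0" using uv w by (simp add: X_add XY)
      moreover have "u + Y w \<noteq> 0" using nb[OF w(1)] w(2) by (auto simp: eq_neg_iff_add_eq_0)
      ultimately show ?thesis using tor2_if_kernel by blast
    next
      case False
      then show ?thesis using tor0_if_not_image[OF uv(2)] by fastforce
    qed
  qed
qed

lemma tor_bounded: "tor0 a b \<or> tor1 a b \<or> tor2 a b \<Longrightarrow> b \<le> N + 1"
  unfolding tor0_def tor1_def tor2_def
proof (elim disjE bexE conjE)
  fix u assume "u \<in> G a b" "\<forall>v\<in>G (a - 1) b. \<forall>w\<in>G a (b - 1). u \<noteq> X v + Y w"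
  then show "b \<le> N + 1" using bounded G0[of "a - 1" b] G0[of a "b - 1"] by fastforce
next
  fix u v
  assume uv: "u \<in> G (a - 1) b" "v \<in> G a (b - 1)"
    and "\<forall>w\<in>G (a - 1) (b - 1). u = - Y w \<longrightarrow> v \<noteq> X w"
  then have "u \<noteq> 0 \<or> v \<noteq> 0" using G0[of "a - 1" "b - 1"] by fastforce
  then show "b \<le> N + 1" using bounded uv by fastforce
next
  fix u assume "u \<in> G (a - 1) (b - 1)" "u \<noteq> 0"
  then show "b \<le> N + 1" using bounded by fastforce
qed

lemma row_law_tor: "column_law (\<lambda>b a. tor0 a b) (\<lambda>b a. tor1 a b) (\<lambda>b a. tor2 a b)"
proof -
  interpret flip: bigraded_pair Y X "\<lambda>b a. G a b" N
    by unfold_locales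
      (auto simp: X_add Y_add XY G0 intro: G_add G_minus G_X G_Y dest: bounded)
  have "flip.tor0 = (\<lambda>b a. tor0 a b)"
    unfolding flip.tor0_def tor0_def fun_eq_iff by (metis add.commute)
  moreover have "flip.tor1 = (\<lambda>b a. tor1 a b)"
  proof (intro ext iffI)
    fix b a
    show "tor1 a b" if t: "flip.tor1 b a"
    proof -
      obtain u v where uv: "u \<in> G a (b - 1)" "v \<in> G (a - 1) b" "Y u + X v = 0"
        and nb: "\<And>w. w \<in> G (a - 1) (b - 1) \<Longrightarrow> u = - X w \<Longrightarrow> v \<noteq> Y w"
        using t unfolding flip.tor1_def by blast
      have "v = - Y w \<longrightarrow> u \<noteq> X w" if "w \<in> G (a - 1) (b - 1)" for w
        using nb[OF G_minus[OF that]] by (auto simp: X_minus Y_minus)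
      then show ?thesis unfolding tor1_def using uv
        by (intro bexI[of _ v] bexI[of _ u]) (auto simp: add.commute)
    qed
    show "flip.tor1 b a" if t: "tor1 a b"
    proof -
      obtain u v where uv: "u \<in> G (a - 1) b" "v \<in> G a (b - 1)" "X u + Y v = 0"
        and nb: "\<And>w. w \<in> G (a - 1) (b - 1) \<Longrightarrow> u = - Y w \<Longrightarrow> v \<noteq> X w"
        using t unfolding tor1_def by blast
      have "v = - X w \<longrightarrow> u \<noteq> Y w" if "w \<in> G (a - 1) (b - 1)" for w
        using nb[OF G_minus[OF that]] by (auto simp: X_minus Y_minus)
      then show ?thesis unfolding flip.tor1_def using uv
        by (intro bexI[of _ v] bexI[of _ u]) (auto simp: add.commute)
    qed
  qed
  moreover have "flip.tor2 = (\<lambda>b a. tor2 a b)"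
    unfolding flip.tor2_def tor2_def by (auto simp: fun_eq_iff)
  ultimately show ?thesis using flip.column_law_tor by simp
qed

end

section \<open>Graded components of a module of finite length\<close>

context bigraded_module
begin

definition component :: "'m \<Rightarrow> bideg \<Rightarrow> 'm" where
  "component u = (THE f. finite {\<alpha>. f \<alpha> \<noteq> 0} \<and> (\<forall>\<alpha>. f \<alpha> \<in> G \<alpha>) \<and> u = (\<Sum>\<alpha> | f \<alpha> \<noteq> 0. f \<alpha>))"

lemma component_props: "finite {\<alpha>. component u \<alpha> \<noteq> 0}" "component u \<alpha> \<in> G \<alpha>" "u = (\<Sum>\<alpha> | component u \<alpha> \<noteq> 0. component u \<alpha>)"
  using theI'[OF direct_sum[of u]] unfolding component_def by blast+

text \<open>The grading speaks of the exact support \<open>f \<alpha> \<noteq> 0\<close>; a finite superset \<open>A\<close> is easier to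
  provide for sums and multiples.\<close>

lemma component_eqI:
  assumes "finite A" "\<And>\<alpha>. \<alpha> \<notin> A \<Longrightarrow> f \<alpha> = 0" "\<And>\<alpha>. f \<alpha> \<in> G \<alpha>" "u = (\<Sum>\<alpha>\<in>A. f \<alpha>)"
  shows "component u = f"
proof -
  have sub: "{\<alpha>. f \<alpha> \<noteq> 0} \<subseteq> A" using assms(2) by blast
  moreover have "(\<Sum>\<alpha>\<in>A. f \<alpha>) = (\<Sum>\<alpha> | f \<alpha> \<noteq> 0. f \<alpha>)"
    by (rule sum.mono_neutral_right) (use assms(1) sub in auto)
  ultimately show ?thesis
    unfolding component_def using assms direct_sum[of u] finite_subset
    by (intro the1_equality) auto
qed

lemma component_homogeneous: "u \<in> G \<alpha> \<Longrightarrow> component u = (\<lambda>\<beta>. if \<beta> = \<alpha> then u else 0)"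
  by (rule component_eqI[of "{\<alpha>}"]) (auto simp: zero_closed)

lemma component_zero: "component 0 \<alpha> = 0"
  using component_homogeneous[OF zero_closed, of \<alpha>] by simp

lemma component_add: "component (u + v) \<alpha> = component u \<alpha> + component v \<alpha>"
proof -
  let ?A = "{\<alpha>. component u \<alpha> \<noteq> 0}" and ?B = "{\<alpha>. component v \<alpha> \<noteq> 0}"
  have "w = (\<Sum>\<alpha>\<in>?A \<union> ?B. component w \<alpha>)" if "w = u \<or> w = v" for w
    using component_props(1)[of u] component_props(1)[of v] that
    by (subst component_props(3)[of w], intro sum.mono_neutral_left) auto
  from this[of u] this[of v] have eq: "u + v = (\<Sum>\<alpha>\<in>?A \<union> ?B. component u \<alpha> + component v \<alpha>)"
    by (simp add: sum.distrib)
  have "component (u + v) = (\<lambda>\<alpha>. component u \<alpha> + component v \<alpha>)"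
    by (rule component_eqI[OF _ _ _ eq]) (auto intro: add_closed component_props)
  then show ?thesis by simp
qed

lemma component_scale:
  assumes "homogeneous \<beta> p"
  shows "component (s p u) \<alpha> = s p (component u (\<alpha> - \<beta>))"
proof -
  let ?A = "{\<alpha>. component u \<alpha> \<noteq> 0}"
  have "s p u = (\<Sum>\<alpha>\<in>?A. s p (component u \<alpha>))"
    using component_props(3)[of u] scale_sum_right by metis
  also have "\<dots> = (\<Sum>\<alpha>\<in>(\<lambda>\<alpha>. \<alpha> + \<beta>) ` ?A. s p (component u (\<alpha> - \<beta>)))"
    by (subst sum.reindex) (auto simp: inj_on_def)
  finally have eq: "s p u = (\<Sum>\<alpha>\<in>(\<lambda>\<alpha>. \<alpha> + \<beta>) ` ?A. s p (component u (\<alpha> - \<beta>)))" .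
  have "component (s p u) = (\<lambda>\<alpha>. s p (component u (\<alpha> - \<beta>)))"
  proof (rule component_eqI[OF _ _ _ eq])
    show "finite ((\<lambda>\<alpha>. \<alpha> + \<beta>) ` ?A)" using component_props(1) by simp
    show "s p (component u (\<alpha> - \<beta>)) \<in> G \<alpha>" for \<alpha>
      using scale_closed[OF assms component_props(2), of u "\<alpha> - \<beta>"] by simp
    show "s p (component u (\<alpha> - \<beta>)) = 0" if "\<alpha> \<notin> (\<lambda>\<alpha>. \<alpha> + \<beta>) ` ?A" for \<alpha>
    proof -
      have "\<alpha> - \<beta> \<notin> ?A" using that by (metis diff_add_cancel image_eqI)
      then show ?thesis by simp
    qed
  qed
  then show ?thesis by simp
qed

lemma homogeneous_monom: "homogeneous (bideg_of n) (monom2 n a)"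
  by (auto simp: homogeneous_def lookup_single when_def)

text \<open>The submodule with prescribed components. All chains of submodules below are of this form,
  so that finite length is used only through families of \<open>k\<close>-subspaces.\<close>

definition graded_sub :: "(bideg \<Rightarrow> 'm set) \<Rightarrow> 'm set" where
  "graded_sub W = {u. \<forall>\<alpha>. component u \<alpha> \<in> W \<alpha>}"

lemma subspace_graded_sub:
  assumes "\<And>\<alpha>. 0 \<in> W \<alpha>" "\<And>\<alpha> u v. u \<in> W \<alpha> \<Longrightarrow> v \<in> W \<alpha> \<Longrightarrow> u + v \<in> W \<alpha>"
    "\<And>\<alpha> n a u. u \<in> W \<alpha> \<Longrightarrow> s (monom2 n a) u \<in> W (\<alpha> + bideg_of n)"
  shows "subspace (graded_sub W)"
proof (rule subspaceI)
  show "0 \<in> graded_sub W" using assms by (simp add: graded_sub_def component_zero)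
  show add: "u + v \<in> graded_sub W" if "u \<in> graded_sub W" "v \<in> graded_sub W" for u v
    using that assms by (simp add: graded_sub_def component_add)
  have monom: "s (monom2 n a) u \<in> graded_sub W" if "u \<in> graded_sub W" for n a u
  proof -
    have "s (monom2 n a) (component u (\<alpha> - bideg_of n)) \<in> W \<alpha>" for \<alpha>
    proof -
      have "component u (\<alpha> - bideg_of n) \<in> W (\<alpha> - bideg_of n)"
        using that unfolding graded_sub_def by blast
      from assms(3)[OF this, of n a] show ?thesis by simp
    qed
    then show ?thesis by (simp add: graded_sub_def component_scale[OF homogeneous_monom])
  qed
  show "s p u \<in> graded_sub W" if u: "u \<in> graded_sub W" for p u
  proof (induction p rule: update_induct)
    case const
    then show ?case using assms by (simp add: graded_sub_def component_zero)
  next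
    case (update p n a)
    have "Poly_Mapping.update n a p = p + monom2 n a"
      using update by (intro poly_mapping_eqI)
        (auto simp: lookup_update lookup_add lookup_single when_def in_keys_iff)
    then show ?case using add[OF update(3) monom[OF u]] by (simp add: scale_left_distrib)
  qed
qed

lemma graded_sub_strict_mono:
  assumes "\<And>\<alpha>. W \<alpha> \<subseteq> W' \<alpha>" "\<And>\<alpha>. 0 \<in> W \<alpha>" "u \<in> W' \<alpha>" "u \<notin> W \<alpha>" "u \<in> G \<alpha>"
  shows "graded_sub W \<subset> graded_sub W'"
proof -
  have "component u \<beta> \<in> W' \<beta>" for \<beta>
    using assms(1)[of \<beta>] assms(2)[of \<beta>] assms(3) component_homogeneous[OF assms(5)] by auto
  moreover have "component u \<alpha> \<notin> W \<alpha>" using assms(4) component_homogeneous[OF assms(5)] by simp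
  ultimately have "u \<in> graded_sub W'" "u \<notin> graded_sub W"
    unfolding graded_sub_def by blast+
  moreover have "graded_sub W \<subseteq> graded_sub W'" using assms(1) unfolding graded_sub_def by blast
  ultimately show ?thesis by blast
qed

definition kscale :: "'k \<Rightarrow> 'm \<Rightarrow> 'm" where
  "kscale a = s (monom2 0 a)"

sublocale K: vector_space kscale
  by unfold_locales
    (auto simp: kscale_def scale_right_distrib single_add scale_left_distrib mult_single)

lemma kscale_closed: "u \<in> G \<alpha> \<Longrightarrow> kscale a u \<in> G \<alpha>"
  using scale_closed[OF homogeneous_monom, of u \<alpha> 0 a]
  by (simp add: kscale_def bideg_of_def zero_prod_def[symmetric])

lemma K_subspace_G: "K.subspace (G \<alpha>)"
  by (rule K.subspaceI) (auto intro: zero_closed add_closed kscale_closed)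

lemma minus_closed: "u \<in> G \<alpha> \<Longrightarrow> - u \<in> G \<alpha>"
  using K.subspace_neg[OF K_subspace_G] .

end

locale finite_length_module = bigraded_module s G
  for s :: "'k::field bipoly \<Rightarrow> 'm::ab_group_add \<Rightarrow> 'm" and G :: "bideg \<Rightarrow> 'm set" +
  assumes fl: "finite_length s"
begin

lemma chain_bound:
  obtains N where "\<And>n C. \<lbrakk>\<And>i. i \<le> n \<Longrightarrow> subspace (C i); \<And>i. i < n \<Longrightarrow> C i \<subset> C (Suc i)\<rbrakk> \<Longrightarrow> n \<le> N"
  using fl unfolding finite_length_def by metis

text \<open>If a degree function \<open>d\<close> that grows under multiplication, such as the \<open>x\<close>-degree or the
  \<open>y\<close>-degree, took infinitely many values on \<open>M\<close>, then the submodules of elements of \<open>d\<close>-degree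
  above given thresholds would form arbitrarily long chains.\<close>

lemma finite_degrees:
  fixes d :: "bideg \<Rightarrow> int"
  assumes d: "\<And>\<alpha> n. d \<alpha> \<le> d (\<alpha> + bideg_of n)"
  shows "finite (d ` {\<alpha>. G \<alpha> \<noteq> {0}})"
proof (rule ccontr)
  let ?D = "d ` {\<alpha>. G \<alpha> \<noteq> {0}}"
  assume inf: "infinite ?D"
  obtain N where N: "\<And>n C. \<lbrakk>\<And>i. i \<le> n \<Longrightarrow> subspace (C i); \<And>i. i < n \<Longrightarrow> C i \<subset> C (Suc i)\<rbrakk> \<Longrightarrow> n \<le> N"
    using chain_bound by metis
  obtain E where E: "E \<subseteq> ?D" "finite E" "card E = Suc N"
    using infinite_arbitrarily_large[OF inf] by blast
  define W where "W E' \<alpha> = (if \<forall>e\<in>E'. e < d \<alpha> then G \<alpha> else {0})" for E' :: "int set" and \<alpha>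
  \<comment> \<open>Descending, since a smaller threshold gives a larger submodule.\<close>
  define l where "l = rev (sorted_list_of_set E)"
  have l: "length l = Suc N" "sorted_wrt (>) l" "set l = E"
    using E strict_sorted_list_of_set[of E] by (auto simp: l_def sorted_wrt_rev)
  define C where "C i = graded_sub (W (set (drop i l)))" for i
  have "Suc N \<le> N"
  proof (rule N)
    show "subspace (C i)" for i
      unfolding C_def
    proof (rule subspace_graded_sub)
      fix \<alpha> n a u assume u: "u \<in> W (set (drop i l)) \<alpha>"
      show "s (monom2 n a) u \<in> W (set (drop i l)) (\<alpha> + bideg_of n)"
        using u scale_closed[OF homogeneous_monom] zero_closed less_le_trans[OF _ d]
        by (auto simp: W_def split: if_splits)
    qed (auto simp: W_def zero_closed add_closed split: if_splits)
    show "C i \<subset> C (Suc i)" if i: "i < Suc N" for i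
    proof -
      have dr: "drop i l = l ! i # drop (Suc i) l" using i l by (simp add: Cons_nth_drop_Suc)
      obtain \<alpha> where \<alpha>: "G \<alpha> \<noteq> {0}" "d \<alpha> = l ! i" using E l i nth_mem[of i l] by fastforce
      obtain u where u: "u \<in> G \<alpha>" "u \<noteq> 0" using \<alpha> zero_closed[of \<alpha>] by blast
      have lt: "e < l ! i" if "e \<in> set (drop (Suc i) l)" for e
        using l(2) i l(1) that by (metis Cons_nth_drop_Suc sorted_wrt.simps(2) sorted_wrt_drop)
      show ?thesis
        unfolding C_def
      proof (rule graded_sub_strict_mono)
        show "W (set (drop i l)) \<beta> \<subseteq> W (set (drop (Suc i) l)) \<beta>" for \<beta>
          using zero_closed by (auto simp: W_def dr)
        show "0 \<in> W (set (drop i l)) \<beta>" for \<beta> by (simp add: W_def zero_closed)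
        show "u \<in> W (set (drop (Suc i) l)) \<alpha>" using lt \<alpha> u by (simp add: W_def)
        show "u \<notin> W (set (drop i l)) \<alpha>" using \<alpha> u by (simp add: W_def dr)
        show "u \<in> G \<alpha>" by (fact u)
      qed
    qed
  qed
  then show False by simp
qed

text \<open>A flag of subspaces \<open>V i\<close> of \<open>G \<alpha>\<close>, completed by everything in the bidegrees above \<open>\<alpha>\<close>, is a
  chain of submodules.\<close>

lemma fin_dim_G: "K.fin_dim (G \<alpha>)"
proof -
  obtain N where N: "\<And>n C. \<lbrakk>\<And>i. i \<le> n \<Longrightarrow> subspace (C i); \<And>i. i < n \<Longrightarrow> C i \<subset> C (Suc i)\<rbrakk> \<Longrightarrow> n \<le> N"
    using chain_bound by metis
  show ?thesis
  proof (rule K.fin_dim_if_independent_bounded)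
    fix B assume B: "finite B" "B \<subseteq> G \<alpha>" "K.independent B"
    obtain l where l: "set l = B" "distinct l" using finite_distinct_list B(1) by blast
    define V where "V i = K.span (set (take i l))" for i
    have VG: "V i \<subseteq> G \<alpha>" for i
      unfolding V_def using B l set_take_subset[of i l] by (intro K.span_minimal K_subspace_G) auto
    define W where "W i \<beta> = (if \<beta> = \<alpha> then V i else if fst \<alpha> \<le> fst \<beta> \<and> snd \<alpha> \<le> snd \<beta> then G \<beta> else {0})" for i \<beta>
    have "length l \<le> N"
    proof (rule N[of _ "\<lambda>i. graded_sub (W i)"])
      fix i assume "i \<le> length l"
      show "subspace (graded_sub (W i))"
      proof (rule subspace_graded_sub)
        fix \<beta> n a u assume u: "u \<in> W i \<beta>"
        show "s (monom2 n a) u \<in> W i (\<beta> + bideg_of n)"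
        proof (cases "n = 0")
          case True
          then have "s (monom2 n a) u = kscale a u" "bideg_of n = 0"
            by (auto simp: kscale_def bideg_of_def zero_prod_def)
          then show ?thesis using u kscale_closed K.span_scale
            by (auto simp: W_def V_def split: if_splits)
        next
          case False
          then have n: "\<not> (fst \<beta> + int (fst n) \<le> fst \<beta> \<and> snd \<beta> + int (snd n) \<le> snd \<beta>)"
            by (cases n) (auto simp: zero_prod_def)
          then have "bideg_of n \<noteq> 0" by (auto simp: bideg_of_def zero_prod_def)
          have "W i \<beta> \<subseteq> (if fst \<alpha> \<le> fst \<beta> \<and> snd \<alpha> \<le> snd \<beta> then G \<beta> else {0})"
            using VG by (auto simp: W_def)
          with \<open>bideg_of n \<noteq> 0\<close> show ?thesis using u n scale_closed[OF homogeneous_monom, of u \<beta> n a] zero_closed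
              K.span_zero
            by (auto simp: W_def V_def bideg_of_def split: if_splits)
        qed
      qed (auto simp: W_def V_def K.span_zero K.span_add zero_closed intro: add_closed)
    next
      fix i assume i: "i < length l"
      have tk: "take (Suc i) l = take i l @ [l ! i]" using i by (simp add: take_Suc_conv_app_nth)
      have "l ! i \<notin> set (take i l)" using l i by (metis distinct_append tk distinct_take not_distinct_conv_prefix)
      moreover have "K.independent (insert (l ! i) (set (take i l)))"
        using K.independent_mono[OF B(3)] l set_take_subset[of i l] nth_mem[OF i] by auto
      ultimately have nin: "l ! i \<notin> V i" by (auto simp: V_def K.independent_insert)
      show "graded_sub (W i) \<subset> graded_sub (W (Suc i))"
      proof (rule graded_sub_strict_mono)
        show "W i \<beta> \<subseteq> W (Suc i) \<beta>" for \<beta>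
          by (auto simp: W_def V_def tk intro: K.span_mono[THEN subsetD, rotated])
        show "0 \<in> W i \<beta>" for \<beta> by (auto simp: W_def V_def K.span_zero zero_closed)
        show "l ! i \<in> W (Suc i) \<alpha>" by (auto simp: W_def V_def tk intro: K.span_base)
        show "l ! i \<notin> W i \<alpha>" using nin by (simp add: W_def)
        show "l ! i \<in> G \<alpha>" using B l i by auto
      qed
    qed
    then show "card B \<le> N" using l distinct_card by metis
  qed
qed

lemma degrees_bounded:
  obtains N where "\<And>a b u. u \<in> G (a, b) \<Longrightarrow> u \<noteq> 0 \<Longrightarrow> \<bar>a\<bar> \<le> N \<and> \<bar>b\<bar> \<le> N"
proof -
  have "finite (fst ` {\<alpha>. G \<alpha> \<noteq> {0}} \<union> snd ` {\<alpha>. G \<alpha> \<noteq> {0}})"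
    using finite_degrees[of fst] finite_degrees[of snd] by (simp add: bideg_of_def)
  then have "finite (abs ` (fst ` {\<alpha>. G \<alpha> \<noteq> {0}} \<union> snd ` {\<alpha>. G \<alpha> \<noteq> {0}}))" (is "finite ?A")
    by simp
  then have N: "x \<le> Max ?A" if "x \<in> ?A" for x using that by simp
  show ?thesis
  proof (rule that)
    fix a b u assume "u \<in> G (a, b)" "u \<noteq> 0"
    then have "(a, b) \<in> {\<alpha>. G \<alpha> \<noteq> {0}}" by blast
    then have "\<bar>a\<bar> \<in> ?A" "\<bar>b\<bar> \<in> ?A" by force+
    then show "\<bar>a\<bar> \<le> Max ?A \<and> \<bar>b\<bar> \<le> Max ?A" using N by blast
  qed
qed

end

section \<open>Betti numbers\<close>

context bigraded_module
begin

definition X :: "'m \<Rightarrow> 'm" where "X = s polyX"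
definition Y :: "'m \<Rightarrow> 'm" where "Y = s polyY"

lemma X_add: "X (u + v) = X u + X v" and Y_add: "Y (u + v) = Y u + Y v"
  by (simp_all add: X_def Y_def scale_right_distrib)

definition chains :: "nat \<Rightarrow> bideg \<Rightarrow> (nat \<Rightarrow> 'm) set" where
  "chains i \<alpha> = free_chains_at G (koszul :: 'k free_complex) i \<alpha>"

abbreviation cycles :: "nat \<Rightarrow> bideg \<Rightarrow> (nat \<Rightarrow> 'm) set" where
  "cycles i \<alpha> \<equiv> {u \<in> chains i \<alpha>. bd s koszul i u = 0}"

abbreviation boundaries :: "nat \<Rightarrow> bideg \<Rightarrow> (nat \<Rightarrow> 'm) set" where
  "boundaries i \<alpha> \<equiv> bd s koszul (Suc i) ` chains (Suc i) \<alpha>"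

lemma X_closed: "u \<in> G (a - 1, b) \<Longrightarrow> X u \<in> G (a, b)"
  using scale_closed[of "(1, 0)" polyX u "(a - 1, b)"] homogeneous_monom[of "(1, 0)" 1]
  by (simp add: X_def bideg_of_def)

lemma Y_closed: "u \<in> G (a, b - 1) \<Longrightarrow> Y u \<in> G (a, b)"
  using scale_closed[of "(0, 1)" polyY u "(a, b - 1)"] homogeneous_monom[of "(0, 1)" 1]
  by (simp add: Y_def bideg_of_def)

lemma XY_commute: "X (Y u) = Y (X u)"
  unfolding X_def Y_def by (rule scale_left_commute)

lemma X_minus: "X (- u) = - X u"
  by (simp add: X_def)

lemma chains_0: "u \<in> chains 0 (a, b) \<longleftrightarrow> u 0 \<in> G (a, b) \<and> (\<forall>c\<ge>1. u c = 0)"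
  by (auto simp: chains_def free_chains_at_def free_chains_def koszul_def)

lemma chains_1: "u \<in> chains 1 (a, b) \<longleftrightarrow> u 0 \<in> G (a - 1, b) \<and> u 1 \<in> G (a, b - 1) \<and> (\<forall>c\<ge>2. u c = 0)"
  by (auto simp: chains_def free_chains_at_def free_chains_def koszul_def less_Suc_eq numeral_2_eq_2)

lemma chains_2: "u \<in> chains 2 (a, b) \<longleftrightarrow> u 0 \<in> G (a - 1, b - 1) \<and> (\<forall>c\<ge>1. u c = 0)"
  by (auto simp: chains_def free_chains_at_def free_chains_def koszul_def)

lemma chains_3: "chains 3 \<alpha> = {0}"
  by (auto simp: chains_def free_chains_at_def free_chains_def koszul_def fun_eq_iff)

lemma bd_0: "bd s koszul 0 u = 0"
  by (simp add: bd_def zero_fun_def)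

lemma bd_1: "bd s koszul 1 u = (\<lambda>r. if r = 0 then X (u 0) + Y (u 1) else 0)"
  by (auto simp: X_def Y_def bd_def koszul_def fun_eq_iff)

lemma bd_2: "bd s koszul 2 u = (\<lambda>r. if r = 0 then - Y (u 0) else if r = 1 then X (u 0) else 0)"
  by (auto simp: X_def Y_def bd_def koszul_def fun_eq_iff less_Suc_eq scale_minus_left)

sublocale L: vector_space "chain_scale s"
  by unfold_locales
    (auto simp: chain_scale_def fun_eq_iff K.scale_right_distrib K.scale_left_distrib simp flip: kscale_def)

lemma linear_bd: "Vector_Spaces.linear (chain_scale s) (chain_scale s) (bd s F i)"
proof (unfold_locales, goal_cases)
  case (1 u v)
  then show ?case by (auto simp: bd_def fun_eq_iff scale_right_distrib sum.distrib)
next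
  case (2 a u)
  then show ?case
    by (auto simp: bd_def chain_scale_def fun_eq_iff scale_sum_right mult.commute intro!: sum.cong)
qed

lemma linear_eval: "Vector_Spaces.linear (chain_scale s) kscale (\<lambda>u. u c)"
  by unfold_locales (auto simp: chain_scale_def kscale_def)

definition single_chain :: "nat \<Rightarrow> 'm \<Rightarrow> nat \<Rightarrow> 'm" where
  "single_chain c x = (\<lambda>j. if j = c then x else 0)"

lemma linear_single_chain: "Vector_Spaces.linear kscale (chain_scale s) (single_chain c)"
  by unfold_locales (auto simp: chain_scale_def kscale_def single_chain_def fun_eq_iff)

lemma subspace_chains: "L.subspace (chains i \<alpha>)"
proof (rule L.subspaceI)
  show "chain_scale s a u \<in> chains i \<alpha>" if "u \<in> chains i \<alpha>" for a u
    using that kscale_closed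
    by (auto simp: chains_def free_chains_at_def free_chains_def chain_scale_def simp flip: kscale_def)
qed (auto simp: chains_def free_chains_at_def free_chains_def zero_closed add_closed)

lemma subspace_cycles: "L.subspace (cycles i \<alpha>)"
proof -
  interpret linear "chain_scale s" "chain_scale s" "bd s koszul i" by (rule linear_bd)
  have "L.subspace (chains i \<alpha> \<inter> {u. bd s koszul i u = 0})"
    by (intro L.subspace_inter subspace_chains subspace_kernel)
  then show ?thesis by (simp add: Int_def)
qed

lemma subspace_boundaries: "L.subspace (boundaries i \<alpha>)"
proof -
  interpret linear "chain_scale s" "chain_scale s" "bd s koszul (Suc i)" by (rule linear_bd)
  show ?thesis by (intro subspace_image subspace_chains)
qed

lemma boundaries_2: "boundaries 2 \<alpha> = {0}"
proof -
  interpret linear "chain_scale s" "chain_scale s" "bd s koszul (Suc 2)" by (rule linear_bd)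
  show ?thesis using chains_3 zero by simp
qed

lemma boundaries_subset_cycles:
  assumes "i \<le> 2"
  shows "boundaries i (a, b) \<subseteq> cycles i (a, b)"
proof -
  consider "i = 0" | "i = 1" | "i = 2" using assms by linarith
  then show ?thesis
  proof cases
    case 1
    then show ?thesis
      using chains_1[of _ a b] bd_1 bd_0 X_closed Y_closed
      by (auto simp: chains_0 add_closed)
  next
    case 2
    have "bd s koszul 2 u \<in> cycles 1 (a, b)" if "u \<in> chains 2 (a, b)" for u
    proof -
      have u: "u 0 \<in> G (a - 1, b - 1)" using that chains_2 by blast
      have "bd s koszul 2 u \<in> chains 1 (a, b)"
        unfolding chains_1 bd_2 using u X_closed[of "u 0" a "b - 1"] Y_closed[of "u 0" "a - 1" b]
        by (auto intro: minus_closed)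
      moreover have "bd s koszul 1 (bd s koszul 2 u) = 0"
        by (simp only: bd_1 bd_2) (simp add: fun_eq_iff XY_commute X_minus)
      ultimately show ?thesis by simp
    qed
    then show ?thesis using 2 by (auto simp: numeral_2_eq_2)
  next
    case 3
    then show ?thesis using boundaries_2 L.subspace_0[OF subspace_cycles] by auto
  qed
qed

end

lemma sum_differences_zero:
  fixes g :: "int \<Rightarrow> int"
  assumes "\<And>b. g b \<noteq> 0 \<Longrightarrow> \<bar>b\<bar> \<le> N" "finite A" "\<And>b. b \<notin> A \<Longrightarrow> g b = g (b - 1)"
  shows "(\<Sum>b\<in>A. g b - g (b - 1)) = 0"
proof -
  let ?S = "A \<union> {- N..N + 1}"
  have "(\<Sum>b\<in>A. g b - g (b - 1)) = (\<Sum>b\<in>?S. g b - g (b - 1))"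
    by (rule sum.mono_neutral_left) (use assms in auto)
  also have "\<dots> = (\<Sum>b\<in>?S. g b) - (\<Sum>b\<in>?S. g (b - 1))" by (rule sum_subtractf)
  also have "(\<Sum>b\<in>?S. g b) = (\<Sum>b\<in>{- N..N}. g b)"
    by (rule sum.mono_neutral_right) (use assms(1,2) in \<open>auto, fastforce+\<close>)
  also have "(\<Sum>b\<in>?S. g (b - 1)) = (\<Sum>b\<in>{- N + 1..N + 1}. g (b - 1))"
    by (rule sum.mono_neutral_right) (use assms(1)[of "_ - 1"] assms(2) in \<open>auto, fastforce+\<close>)
  also have "\<dots> = (\<Sum>b\<in>{- N..N}. g b)"
    by (rule sum.reindex_bij_witness[of _ "\<lambda>b. b + 1" "\<lambda>b. b - 1"]) auto
  finally show ?thesis by simp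
qed

context finite_length_module
begin

definition hilb :: "int \<Rightarrow> int \<Rightarrow> int" where
  "hilb a b = int (K.dim (G (a, b)))"

text \<open>Dimensions in the chain spaces are measured by two \<open>k\<close>-linear maps, the embeddings of \<open>G \<alpha>\<close>
  as one coordinate and the evaluation at a coordinate.\<close>

lemma single_chain_image:
  "L.fin_dim (single_chain c ` G \<alpha>)" "L.dim (single_chain c ` G \<alpha>) = K.dim (G \<alpha>)"
proof -
  interpret linear kscale "chain_scale s" "single_chain c" by (rule linear_single_chain)
  show "L.fin_dim (single_chain c ` G \<alpha>)" by (intro fin_dim_image fin_dim_G)
  show "L.dim (single_chain c ` G \<alpha>) = K.dim (G \<alpha>)"
    by (intro dim_injective_image K_subspace_G fin_dim_G) (auto simp: single_chain_def fun_eq_iff split: if_splits)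
qed

lemma chains_0_image: "chains 0 (a, b) = single_chain 0 ` G (a, b)"
  by (auto simp: set_eq_iff chains_0 image_iff single_chain_def fun_eq_iff)

lemma chains_2_image: "chains 2 (a, b) = single_chain 0 ` G (a - 1, b - 1)"
  by (auto simp: set_eq_iff chains_2 image_iff single_chain_def fun_eq_iff)

lemma fin_dim_chains_1: "L.fin_dim (chains 1 (a, b))"
proof -
  obtain B0 where B0: "finite B0" "single_chain 0 ` G (a - 1, b) \<subseteq> L.span B0"
    using single_chain_image(1) unfolding L.fin_dim_def by blast
  obtain B1 where B1: "finite B1" "single_chain 1 ` G (a, b - 1) \<subseteq> L.span B1"
    using single_chain_image(1) unfolding L.fin_dim_def by blast
  have "chains 1 (a, b) \<subseteq> L.span (B0 \<union> B1)"
  proof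
    fix u assume u: "u \<in> chains 1 (a, b)"
    then have "u = single_chain 0 (u 0) + single_chain 1 (u 1)"
      unfolding chains_1 by (auto simp: single_chain_def fun_eq_iff)
    moreover have "single_chain 0 (u 0) \<in> L.span (B0 \<union> B1)" "single_chain 1 (u 1) \<in> L.span (B0 \<union> B1)"
      using u B0 B1 L.span_mono[of B0 "B0 \<union> B1"] L.span_mono[of B1 "B0 \<union> B1"]
      unfolding chains_1 by blast+
    ultimately show "u \<in> L.span (B0 \<union> B1)" by (metis L.span_add)
  qed
  then show ?thesis using B0 B1 unfolding L.fin_dim_def by blast
qed

lemma fin_dim_chains: "i \<le> 2 \<Longrightarrow> L.fin_dim (chains i (a, b))"
proof -
  assume "i \<le> 2"
  then consider "i = 0" | "i = 1" | "i = 2" by linarith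
  then show ?thesis
    using fin_dim_chains_1 chains_0_image chains_2_image single_chain_image(1) by cases auto
qed

lemma fin_dim_cycles: "i \<le> 2 \<Longrightarrow> L.fin_dim (cycles i (a, b))"
  by (rule L.fin_dim_subset[OF fin_dim_chains]) auto

lemma dim_chains_1: "L.dim (chains 1 (a, b)) = K.dim (G (a - 1, b)) + K.dim (G (a, b - 1))"
proof -
  interpret linear "chain_scale s" kscale "\<lambda>u. u 0" by (rule linear_eval)
  have "{u \<in> chains 1 (a, b). u 0 = 0} = single_chain 1 ` G (a, b - 1)"
    unfolding chains_1
  proof (intro equalityI subsetI; clarify)
    fix u :: "nat \<Rightarrow> 'm" assume "u 1 \<in> G (a, b - 1)" "\<forall>c\<ge>2. u c = 0" "u 0 = 0"
    then have "u = single_chain 1 (u 1)"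
      by (auto simp: single_chain_def fun_eq_iff) (metis One_nat_def Suc_1 less_2_cases not_le)
    then show "u \<in> single_chain 1 ` G (a, b - 1)" using \<open>u 1 \<in> _\<close> by blast
  qed (auto simp: single_chain_def zero_closed)
  moreover have "(\<lambda>u. u 0) ` chains 1 (a, b) = G (a - 1, b)"
  proof (intro equalityI subsetI)
    fix x assume "x \<in> G (a - 1, b)"
    then have "single_chain 0 x \<in> chains 1 (a, b)"
      unfolding chains_1 by (auto simp: single_chain_def zero_closed)
    then show "x \<in> (\<lambda>u. u 0) ` chains 1 (a, b)" 
      by (rule rev_image_eqI) (simp add: single_chain_def)
  qed (use chains_1 in blast)
  ultimately show ?thesis
    using rank_nullity[OF subspace_chains fin_dim_chains_1] single_chain_image(2) by simp
qed

lemma int_betti: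
  assumes "i \<le> 2"
  shows "int (betti s G i (a, b)) = int (L.dim (cycles i (a, b))) - int (L.dim (boundaries i (a, b)))"
proof -
  have "L.dim (boundaries i (a, b)) \<le> L.dim (cycles i (a, b))"
    using boundaries_subset_cycles[OF assms] fin_dim_cycles[OF assms]
    by (intro L.dim_subspace_le subspace_cycles subspace_boundaries) auto
  then show ?thesis by (simp add: betti_def homology_dim_def chains_def)
qed

lemma betti_eq_0_iff:
  assumes "i \<le> 2"
  shows "betti s G i (a, b) = 0 \<longleftrightarrow> cycles i (a, b) \<subseteq> boundaries i (a, b)"
proof
  assume "betti s G i (a, b) = 0"
  then have "boundaries i (a, b) = cycles i (a, b)"
    using int_betti[OF assms, of a b] boundaries_subset_cycles[OF assms]
      fin_dim_cycles[OF assms]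
    by (intro L.dim_subspace_eq subspace_cycles subspace_boundaries) auto
  then show "cycles i (a, b) \<subseteq> boundaries i (a, b)" by simp
next
  assume "cycles i (a, b) \<subseteq> boundaries i (a, b)"
  then have "boundaries i (a, b) = cycles i (a, b)" using boundaries_subset_cycles[OF assms] by blast
  then show "betti s G i (a, b) = 0" by (simp add: betti_def homology_dim_def chains_def)
qed

text \<open>By rank and nullity the alternating sum of the Betti numbers equals that of the dimensions of
  the Koszul chains, so it is the second mixed difference of the Hilbert function. As the
  latter has finite support, the sum over a column or a row telescopes to zero.\<close>

definition euler :: "int \<Rightarrow> int \<Rightarrow> int" where
  "euler a b = int (betti s G 0 (a, b)) - int (betti s G 1 (a, b)) + int (betti s G 2 (a, b))"

lemma euler_hilb: "euler a b = hilb a b - hilb (a - 1) b - hilb a (b - 1) + hilb (a - 1) (b - 1)"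
proof -
  have rn: "L.dim (chains (Suc i) (a, b)) = L.dim (cycles (Suc i) (a, b)) + L.dim (boundaries i (a, b))"
    if "i \<le> 1" for i
  proof -
    interpret linear "chain_scale s" "chain_scale s" "bd s koszul (Suc i)" by (rule linear_bd)
    show ?thesis using that by (intro rank_nullity subspace_chains fin_dim_chains) auto
  qed
  have "L.dim (boundaries 2 (a, b)) = 0" using boundaries_2 L.dim_zero_subspace by simp
  moreover have "cycles 0 (a, b) = chains 0 (a, b)" by (simp add: bd_0)
  ultimately show ?thesis
    using rn[of 0] rn[of 1] int_betti[of 0 a b] int_betti[of 1 a b] int_betti[of 2 a b]
      dim_chains_1[of a b] chains_0_image[of a b] chains_2_image[of a b] single_chain_image(2)
    unfolding euler_def hilb_def by (simp add: numeral_2_eq_2)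
qed

lemma hilb_bounded:
  obtains N where "\<And>a b. hilb a b \<noteq> 0 \<Longrightarrow> \<bar>a\<bar> \<le> N \<and> \<bar>b\<bar> \<le> N"
proof -
  obtain N where N: "\<And>a b u. u \<in> G (a, b) \<Longrightarrow> u \<noteq> 0 \<Longrightarrow> \<bar>a\<bar> \<le> N \<and> \<bar>b\<bar> \<le> N"
    using degrees_bounded by blast
  have "G (a, b) \<noteq> {0}" if "hilb a b \<noteq> 0" for a b
    using that K.dim_zero_subspace by (auto simp: hilb_def)
  then show ?thesis using that N zero_closed by blast
qed

lemma euler_column:
  assumes "finite A" "\<And>b. b \<notin> A \<Longrightarrow> euler a b = 0"
  shows "(\<Sum>b\<in>A. euler a b) = 0"
proof -
  obtain N where N: "\<And>a b. hilb a b \<noteq> 0 \<Longrightarrow> \<bar>a\<bar> \<le> N \<and> \<bar>b\<bar> \<le> N" using hilb_bounded by blast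
  define g where "g b = hilb a b - hilb (a - 1) b" for b
  have e: "euler a b = g b - g (b - 1)" for b by (simp add: euler_hilb g_def)
  have "g b \<noteq> 0 \<Longrightarrow> \<bar>b\<bar> \<le> N" for b
    using N[of a b] N[of "a - 1" b] by (cases "hilb a b = 0") (auto simp: g_def)
  from sum_differences_zero[OF this assms(1)] show ?thesis using assms(2) e by simp
qed

lemma euler_row:
  assumes "finite A" "\<And>a. a \<notin> A \<Longrightarrow> euler a b = 0"
  shows "(\<Sum>a\<in>A. euler a b) = 0"
proof -
  obtain N where N: "\<And>a b. hilb a b \<noteq> 0 \<Longrightarrow> \<bar>a\<bar> \<le> N \<and> \<bar>b\<bar> \<le> N" using hilb_bounded by blast
  define g where "g a = hilb a b - hilb a (b - 1)" for a
  have e: "euler a b = g a - g (a - 1)" for a by (simp add: euler_hilb g_def)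
  have "g a \<noteq> 0 \<Longrightarrow> \<bar>a\<bar> \<le> N" for a
    using N[of a b] N[of a "b - 1"] by (cases "hilb a b = 0") (auto simp: g_def)
  from sum_differences_zero[OF this assms(1)] show ?thesis using assms(2) e by simp
qed

text \<open>The Betti numbers are nonzero exactly where the predicates \<open>tor0\<close>, \<open>tor1\<close>, \<open>tor2\<close> of the
  multiplications by \<open>x\<close> and \<open>y\<close> hold, because the chain spaces are finite-dimensional and
  equal dimensions force cycles and boundaries to agree.\<close>

lemma betti_laws:
  shows "column_law (\<lambda>a b. betti s G 0 (a, b) \<noteq> 0) (\<lambda>a b. betti s G 1 (a, b) \<noteq> 0) (\<lambda>a b. betti s G 2 (a, b) \<noteq> 0)"
    and "column_law (\<lambda>b a. betti s G 0 (a, b) \<noteq> 0) (\<lambda>b a. betti s G 1 (a, b) \<noteq> 0) (\<lambda>b a. betti s G 2 (a, b) \<noteq> 0)"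
    and "\<exists>N. \<forall>a b. betti s G 0 (a, b) \<noteq> 0 \<or> betti s G 1 (a, b) \<noteq> 0 \<or> betti s G 2 (a, b) \<noteq> 0 \<longrightarrow> b \<le> N"
proof -
  obtain N where N: "\<And>a b u. u \<in> G (a, b) \<Longrightarrow> u \<noteq> 0 \<Longrightarrow> \<bar>a\<bar> \<le> N \<and> \<bar>b\<bar> \<le> N"
    using degrees_bounded by blast
  interpret P: bigraded_pair X Y "\<lambda>a b. G (a, b)" N
    by unfold_locales
      (auto simp: X_add Y_add XY_commute intro: zero_closed add_closed minus_closed X_closed Y_closed dest: N)
  have 0: "betti s G 0 (a, b) \<noteq> 0 \<longleftrightarrow> P.tor0 a b" for a b
  proof -
    have cyc: "cycles 0 (a, b) = single_chain 0 ` G (a, b)" using chains_0_image by (simp add: bd_0)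
    have bdry: "single_chain 0 u \<in> boundaries 0 (a, b) \<longleftrightarrow>
        (\<exists>v\<in>G (a - 1, b). \<exists>w\<in>G (a, b - 1). u = X v + Y w)" for u
    proof
      assume "single_chain 0 u \<in> boundaries 0 (a, b)"
      then obtain c where c: "c \<in> chains 1 (a, b)" "single_chain 0 u = bd s koszul 1 c" by auto
      then have "u = X (c 0) + Y (c 1)"
        unfolding bd_1 single_chain_def by (auto dest: fun_cong[of _ _ 0])
      then show "\<exists>v\<in>G (a - 1, b). \<exists>w\<in>G (a, b - 1). u = X v + Y w"
        using c(1) unfolding chains_1 by blast
    next
      assume "\<exists>v\<in>G (a - 1, b). \<exists>w\<in>G (a, b - 1). u = X v + Y w"
      then obtain v w where vw: "v \<in> G (a - 1, b)" "w \<in> G (a, b - 1)" "u = X v + Y w" by blast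
      define c where "c = (\<lambda>j::nat. if j = 0 then v else if j = 1 then w else 0)"
      have "c \<in> chains 1 (a, b)" unfolding chains_1 using vw by (simp add: c_def)
      moreover have "single_chain 0 u = bd s koszul 1 c"
        unfolding bd_1 using vw by (auto simp: c_def single_chain_def)
      ultimately show "single_chain 0 u \<in> boundaries 0 (a, b)" by auto
    qed
    have "betti s G 0 (a, b) = 0 \<longleftrightarrow> (\<forall>u\<in>G (a, b). single_chain 0 u \<in> boundaries 0 (a, b))"
      unfolding betti_eq_0_iff[of 0, OF le0] cyc by (rule image_subset_iff)
    then show ?thesis unfolding P.tor0_def bdry by simp
  qed
  have 1: "betti s G 1 (a, b) \<noteq> 0 \<longleftrightarrow> P.tor1 a b" for a b
  proof -
    have bdry: "c \<in> boundaries 1 (a, b) \<longleftrightarrow> (\<exists>w\<in>G (a - 1, b - 1). c 0 = - Y w \<and> c 1 = X w)"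
      if "c \<in> chains 1 (a, b)" for c
    proof
      assume "c \<in> boundaries 1 (a, b)"
      then obtain d where d: "d \<in> chains 2 (a, b)" "c = bd s koszul 2 d" by (auto simp: numeral_2_eq_2)
      then show "\<exists>w\<in>G (a - 1, b - 1). c 0 = - Y w \<and> c 1 = X w"
        unfolding chains_2 bd_2 by auto
    next
      assume "\<exists>w\<in>G (a - 1, b - 1). c 0 = - Y w \<and> c 1 = X w"
      then obtain w where w: "w \<in> G (a - 1, b - 1)" "c 0 = - Y w" "c 1 = X w" by blast
      have "\<And>r. r \<noteq> 0 \<Longrightarrow> r \<noteq> 1 \<Longrightarrow> c r = 0"
        using that unfolding chains_1 by (metis One_nat_def less_2_cases not_le)
      then have "c = bd s koszul 2 (single_chain 0 w)"
        unfolding bd_2 using w by (auto simp: single_chain_def)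
      moreover have "single_chain 0 w \<in> chains 2 (a, b)" using w chains_2_image by blast
      ultimately show "c \<in> boundaries 1 (a, b)" by (simp add: numeral_2_eq_2)
    qed
    have cyc: "c \<in> cycles 1 (a, b) \<longleftrightarrow> c \<in> chains 1 (a, b) \<and> X (c 0) + Y (c 1) = 0" for c
      unfolding bd_1 by (auto simp: fun_eq_iff)
    show ?thesis
    proof
      assume "betti s G 1 (a, b) \<noteq> 0"
      then obtain c where c: "c \<in> cycles 1 (a, b)" "c \<notin> boundaries 1 (a, b)"
        using betti_eq_0_iff[of 1 a b] by auto
      then show "P.tor1 a b"
        using cyc bdry unfolding P.tor1_def chains_1
        by (intro bexI[of _ "c 0"] bexI[of _ "c 1"]) auto
    next
      assume "P.tor1 a b"
      then obtain u v where uv: "u \<in> G (a - 1, b)" "v \<in> G (a, b - 1)" "X u + Y v = 0"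
        "\<forall>w\<in>G (a - 1, b - 1). u = - Y w \<longrightarrow> v \<noteq> X w" unfolding P.tor1_def by blast
      define c where "c = (\<lambda>j::nat. if j = 0 then u else if j = 1 then v else 0)"
      have "c \<in> chains 1 (a, b)" unfolding chains_1 using uv by (simp add: c_def)
      then have "c \<in> cycles 1 (a, b)" "c \<notin> boundaries 1 (a, b)"
        using cyc[of c] bdry[of c] uv by (auto simp: c_def)
      then show "betti s G 1 (a, b) \<noteq> 0" using betti_eq_0_iff[of 1 a b] by auto
    qed
  qed
  have 2: "betti s G 2 (a, b) \<noteq> 0 \<longleftrightarrow> P.tor2 a b" for a b
  proof -
    have cyc: "single_chain 0 u \<in> cycles 2 (a, b) \<longleftrightarrow> X u = 0 \<and> Y u = 0" if "u \<in> G (a - 1, b - 1)" for u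
    proof -
      have "single_chain 0 u \<in> chains 2 (a, b)" using that chains_2_image by blast
      then show ?thesis unfolding bd_2 by (auto simp: fun_eq_iff single_chain_def)
    qed
    have "betti s G 2 (a, b) \<noteq> 0 \<longleftrightarrow> (\<exists>c\<in>cycles 2 (a, b). c \<noteq> 0)"
      using betti_eq_0_iff[of 2 a b] boundaries_2 by auto
    also have "\<dots> \<longleftrightarrow> (\<exists>u\<in>G (a - 1, b - 1). single_chain 0 u \<in> cycles 2 (a, b) \<and> u \<noteq> 0)"
      using chains_2_image[of a b] by (auto simp: single_chain_def fun_eq_iff)
    also have "\<dots> \<longleftrightarrow> P.tor2 a b" unfolding P.tor2_def using cyc by blast
    finally show ?thesis .
  qed
  show "column_law (\<lambda>a b. betti s G 0 (a, b) \<noteq> 0) (\<lambda>a b. betti s G 1 (a, b) \<noteq> 0) (\<lambda>a b. betti s G 2 (a, b) \<noteq> 0)"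
    unfolding 0 1 2 by (rule P.column_law_tor)
  show "column_law (\<lambda>b a. betti s G 0 (a, b) \<noteq> 0) (\<lambda>b a. betti s G 1 (a, b) \<noteq> 0) (\<lambda>b a. betti s G 2 (a, b) \<noteq> 0)"
    unfolding 0 1 2 by (rule P.row_law_tor)
  show "\<exists>N. \<forall>a b. betti s G 0 (a, b) \<noteq> 0 \<or> betti s G 1 (a, b) \<noteq> 0 \<or> betti s G 2 (a, b) \<noteq> 0 \<longrightarrow> b \<le> N"
    unfolding 0 1 2 using P.tor_bounded by blast
qed

end

section \<open>Extremality\<close>

lemma matching_graph_edges:
  fixes s :: "'k::field bipoly \<Rightarrow> 'm::ab_group_add \<Rightarrow> 'm" and G
  defines "\<Gamma> \<equiv> matching_graph s G"
  shows "x_edges \<Gamma> = {{\<alpha>, \<beta>} | \<alpha> \<beta>. \<alpha> \<in> verts \<Gamma> \<and> \<beta> \<in> verts \<Gamma> \<and> \<alpha> \<noteq> \<beta> \<and> fst \<alpha> = fst \<beta>}"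
    and "y_edges \<Gamma> = {{\<alpha>, \<beta>} | \<alpha> \<beta>. \<alpha> \<in> verts \<Gamma> \<and> \<beta> \<in> verts \<Gamma> \<and> \<alpha> \<noteq> \<beta> \<and> snd \<alpha> = snd \<beta>}"
  unfolding \<Gamma>_def matching_graph_def Let_def by simp_all

lemma valent_1_1_unique:
  assumes "valent (1, 1) (matching_graph s G)"
    and V: "v \<in> verts (matching_graph s G)" "w \<in> verts (matching_graph s G)"
      "w' \<in> verts (matching_graph s G)"
    and ne: "w \<noteq> v" "w' \<noteq> v"
    and line: "fst w = fst v \<and> fst w' = fst v \<or> snd w = snd v \<and> snd w' = snd v"
  shows "w = w'"
proof -
  let ?\<Gamma> = "matching_graph s G"
  have "card {e \<in> x_edges ?\<Gamma>. v \<in> e} = 1" "card {e \<in> y_edges ?\<Gamma>. v \<in> e} = 1"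
    using assms(1) V(1) by (auto simp: valent_def has_valency_def)
  then obtain ex ey where e: "{e \<in> x_edges ?\<Gamma>. v \<in> e} = {ex}" "{e \<in> y_edges ?\<Gamma>. v \<in> e} = {ey}"
    by (auto simp: card_1_singleton_iff)
  have xe: "{v, u} = ex" if "u \<in> verts ?\<Gamma>" "u \<noteq> v" "fst u = fst v" for u
  proof -
    have "{v, u} \<in> x_edges ?\<Gamma>"
      unfolding matching_graph_edges using V(1) that by (intro CollectI exI[of _ v] exI[of _ u]) auto
    then have "{v, u} \<in> {e \<in> x_edges ?\<Gamma>. v \<in> e}" by simp
    then show ?thesis unfolding e(1) by (rule singletonD)
  qed
  have ye: "{v, u} = ey" if "u \<in> verts ?\<Gamma>" "u \<noteq> v" "snd u = snd v" for u
  proof -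
    have "{v, u} \<in> y_edges ?\<Gamma>"
      unfolding matching_graph_edges using V(1) that by (intro CollectI exI[of _ v] exI[of _ u]) auto
    then have "{v, u} \<in> {e \<in> y_edges ?\<Gamma>. v \<in> e}" by simp
    then show ?thesis unfolding e(2) by (rule singletonD)
  qed
  from line have "{v, w} = {v, w'}"
    using xe[OF V(2) ne(1)] xe[OF V(3) ne(2)] ye[OF V(2) ne(1)] ye[OF V(3) ne(2)] by auto
  then show ?thesis by (auto simp: doubleton_eq_iff)
qed

lemma matching_graph_edgeD:
  assumes "{v, w} \<in> x_edges (matching_graph s G) \<union> y_edges (matching_graph s G)"
  shows "v \<in> verts (matching_graph s G)" "w \<in> verts (matching_graph s G)" "v \<noteq> w"
    "fst v = fst w \<or> snd v = snd w"
  using assms unfolding matching_graph_edges by (auto simp: doubleton_eq_iff)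

lemma (in finite_length_module) euler_pair:
  assumes "v \<noteq> w"
    and "fst v = fst w \<and> (\<forall>u. fst u = fst v \<longrightarrow> u \<noteq> v \<longrightarrow> u \<noteq> w \<longrightarrow> euler (fst u) (snd u) = 0) \<or>
      snd v = snd w \<and> (\<forall>u. snd u = snd v \<longrightarrow> u \<noteq> v \<longrightarrow> u \<noteq> w \<longrightarrow> euler (fst u) (snd u) = 0)"
  shows "euler (fst v) (snd v) + euler (fst w) (snd w) = 0"
proof -
  obtain a b c d where vw: "v = (a, b)" "w = (c, d)" by fastforce
  from assms(2) show ?thesis
  proof
    assume "fst v = fst w \<and> (\<forall>u. fst u = fst v \<longrightarrow> u \<noteq> v \<longrightarrow> u \<noteq> w \<longrightarrow> euler (fst u) (snd u) = 0)"
    then show ?thesis using euler_column[of "{b, d}" a] \<open>v \<noteq> w\<close> vw by auto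
  next
    assume "snd v = snd w \<and> (\<forall>u. snd u = snd v \<longrightarrow> u \<noteq> v \<longrightarrow> u \<noteq> w \<longrightarrow> euler (fst u) (snd u) = 0)"
    then show ?thesis using euler_row[of "{a, c}" b] \<open>v \<noteq> w\<close> vw by auto
  qed
qed

theorem claim5p1:
  fixes s :: "'k::field bipoly \<Rightarrow> 'm::ab_group_add \<Rightarrow> 'm"
    and G :: "bideg \<Rightarrow> 'm set"
  assumes "bigraded_module s G"
    and "finite_length s"
    and "valent (1, 1) (matching_graph s G)"
    and "graph_connected (matching_graph s G)"
  shows "extremal TYPE('a::ab_group_add) TYPE('b::ab_group_add) s G"
proof -
  interpret M: finite_length_module s G
    using assms by (simp add: finite_length_module_def finite_length_module_axioms_def)
  let ?\<Gamma> = "matching_graph s G"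
  have vert: "\<alpha> \<in> verts ?\<Gamma> \<longleftrightarrow> betti s G 0 \<alpha> \<noteq> 0 \<or> betti s G 1 \<alpha> \<noteq> 0 \<or> betti s G 2 \<alpha> \<noteq> 0" for \<alpha>
    by (auto simp: matching_graph_def Let_def)
  obtain N where N: "\<And>a b. (a, b) \<in> verts ?\<Gamma> \<Longrightarrow> b \<le> N"
    using M.betti_laws(3) unfolding vert by blast
  have degree_unique:
    "\<not> (betti s G 0 (a, b) \<noteq> 0 \<and> betti s G 1 (a, b) \<noteq> 0)"
    "\<not> (betti s G 1 (a, b) \<noteq> 0 \<and> betti s G 2 (a, b) \<noteq> 0)"
    "\<not> (betti s G 0 (a, b) \<noteq> 0 \<and> betti s G 2 (a, b) \<noteq> 0)" for a b
  proof -
    have col: "b' = b''" if "(a, b) \<in> verts ?\<Gamma>" "(a, b') \<in> verts ?\<Gamma>" "(a, b'') \<in> verts ?\<Gamma>"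
      "b' \<noteq> b" "b'' \<noteq> b" for a b b' b''
      using valent_1_1_unique[OF assms(3) that(1-3)] that(4,5) by simp
    have row: "a' = a''" if "(a, b) \<in> verts ?\<Gamma>" "(a', b) \<in> verts ?\<Gamma>" "(a'', b) \<in> verts ?\<Gamma>"
      "a' \<noteq> a" "a'' \<noteq> a" for a a' a'' b
      using valent_1_1_unique[OF assms(3) that(1-3)] that(4,5) by simp
    note unique = homological_degree_unique[OF M.betti_laws(1,2)
        col[unfolded vert] row[unfolded vert] N[unfolded vert]]
    show
      "\<not> (betti s G 0 (a, b) \<noteq> 0 \<and> betti s G 1 (a, b) \<noteq> 0)"
      "\<not> (betti s G 1 (a, b) \<noteq> 0 \<and> betti s G 2 (a, b) \<noteq> 0)"
      "\<not> (betti s G 0 (a, b) \<noteq> 0 \<and> betti s G 2 (a, b) \<noteq> 0)"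
      by (rule unique; assumption)+
  qed
  \<comment> \<open>On a vertex with a single homological degree, \<open>\<chi>\<close> is up to sign the weight of the vertex.\<close>
  define \<chi> where "\<chi> \<alpha> = M.euler (fst \<alpha>) (snd \<alpha>)" for \<alpha>
  have \<chi>_nz: "\<chi> \<alpha> \<noteq> 0" if "\<alpha> \<in> verts ?\<Gamma>" for \<alpha>
    using that degree_unique[of "fst \<alpha>" "snd \<alpha>"] unfolding vert \<chi>_def M.euler_def by auto
  have \<chi>_0: "\<chi> \<alpha> = 0" if "\<alpha> \<notin> verts ?\<Gamma>" for \<alpha>
    using that unfolding vert \<chi>_def M.euler_def by simp
  have only_two: "u \<notin> verts ?\<Gamma>"
    if e: "{v, w} \<in> x_edges ?\<Gamma> \<union> y_edges ?\<Gamma>" and u: "u \<noteq> v" "u \<noteq> w"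
      "fst v = fst w \<and> fst u = fst v \<or> snd v = snd w \<and> snd u = snd v" for u v w
    using valent_1_1_unique[OF assms(3) matching_graph_edgeD(1,2)[OF e], of u]
      matching_graph_edgeD(3)[OF e] u by metis
  show ?thesis
    unfolding extremal_def
  proof (intro allI impI, elim conjE)
    fix s' :: "'k bipoly \<Rightarrow> 'a \<Rightarrow> 'a" and G' and s'' :: "'k bipoly \<Rightarrow> 'b \<Rightarrow> 'b" and G''
    assume "bigraded_module s' G'" "finite_length s'"
      and sum: "betti_table s G = betti_table s' G' + betti_table s'' G''"
    then interpret M': finite_length_module s' G'
      by (simp add: finite_length_module_def finite_length_module_axioms_def)
    define \<chi>' where "\<chi>' \<alpha> = M'.euler (fst \<alpha>) (snd \<alpha>)" for \<alpha>
    have le: "betti s' G' i \<alpha> \<le> betti s G i \<alpha>" if "i \<le> 2" for i \<alpha>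
    proof -
      have "(of_nat (betti s G i \<alpha>) :: rat) = of_nat (betti s' G' i \<alpha> + betti s'' G'' i \<alpha>)"
        using fun_cong[OF fun_cong[OF sum, of i], of \<alpha>] that by (simp add: betti_table_def)
      then show ?thesis unfolding of_nat_eq_iff by simp
    qed
    have le0: "betti s' G' i \<alpha> = 0" if "i \<le> 2" "betti s G i \<alpha> = 0" for i \<alpha>
      using le[OF that(1), of \<alpha>] that(2) by simp
    have \<chi>'_0: "\<chi>' \<alpha> = 0" if "\<alpha> \<notin> verts ?\<Gamma>" for \<alpha>
      using that le0 unfolding vert \<chi>'_def M'.euler_def by simp
    have edge: "\<chi> v + \<chi> w = 0 \<and> \<chi>' v + \<chi>' w = 0" if e: "{v, w} \<in> x_edges ?\<Gamma> \<union> y_edges ?\<Gamma>" for v w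
    proof -
      note D = matching_graph_edgeD[OF e] and T = only_two[OF e]
      from D(4) show ?thesis
      proof
        assume h: "fst v = fst w"
        have "u \<notin> verts ?\<Gamma>" if "fst u = fst v" "u \<noteq> v" "u \<noteq> w" for u
          using T[OF that(2,3)] that(1) h by simp
        then have "\<chi> u = 0 \<and> \<chi>' u = 0" if "fst u = fst v" "u \<noteq> v" "u \<noteq> w" for u
          using that \<chi>_0 \<chi>'_0 by blast
        then show ?thesis
          using h unfolding \<chi>_def \<chi>'_def
          by (intro conjI M.euler_pair[OF D(3)] M'.euler_pair[OF D(3)]) simp_all
      next
        assume h: "snd v = snd w"
        have "u \<notin> verts ?\<Gamma>" if "snd u = snd v" "u \<noteq> v" "u \<noteq> w" for u
          using T[OF that(2,3)] that(1) h by simp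
        then have "\<chi> u = 0 \<and> \<chi>' u = 0" if "snd u = snd v" "u \<noteq> v" "u \<noteq> w" for u
          using that \<chi>_0 \<chi>'_0 by blast
        then show ?thesis
          using h unfolding \<chi>_def \<chi>'_def
          by (intro conjI M.euler_pair[OF D(3)] M'.euler_pair[OF D(3)]) simp_all
      qed
    qed
    have "\<exists>q::rat. \<forall>\<alpha>\<in>verts ?\<Gamma>. of_int (\<chi>' \<alpha>) = q * of_int (\<chi> \<alpha>)"
    proof (cases "verts ?\<Gamma> = {}")
      case False
      then obtain \<alpha>\<^sub>0 where \<alpha>\<^sub>0: "\<alpha>\<^sub>0 \<in> verts ?\<Gamma>" by blast
      define q :: rat where "q = of_int (\<chi>' \<alpha>\<^sub>0) / of_int (\<chi> \<alpha>\<^sub>0)"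
      have "of_int (\<chi>' \<alpha>) = q * of_int (\<chi> \<alpha>)" if "\<alpha> \<in> verts ?\<Gamma>" for \<alpha>
      proof -
        have "(\<alpha>\<^sub>0, \<alpha>) \<in> {(a, b). {a, b} \<in> x_edges ?\<Gamma> \<union> y_edges ?\<Gamma>}\<^sup>*"
          using assms(4) \<alpha>\<^sub>0 that unfolding graph_connected_def by blast
        then show ?thesis
        proof induction
          case base
          then show ?case using \<chi>_nz[OF \<alpha>\<^sub>0] by (simp add: q_def)
        next
          \<comment> \<open>Along an edge both Euler characteristics change sign, so their ratio is preserved.\<close>
          case (step v w)
          then have "\<chi> w = - \<chi> v" "\<chi>' w = - \<chi>' v" using edge[of v w] by auto
          then show ?case using step.IH by simp
        qed
      qed
      then show ?thesis by blast
    qed simp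
    then obtain q :: rat where q: "\<And>\<alpha>. \<alpha> \<in> verts ?\<Gamma> \<Longrightarrow> of_int (\<chi>' \<alpha>) = q * of_int (\<chi> \<alpha>)" by blast
    have "of_nat (betti s' G' i \<alpha>) = q * of_nat (betti s G i \<alpha>)" if "i \<le> 2" for i \<alpha>
    proof (cases "betti s G i \<alpha> = 0")
      case True
      then show ?thesis using le0[OF that] by simp
    next
      case False
      have i: "i = 0 \<or> i = 1 \<or> i = 2" using that by linarith
      then have "\<alpha> \<in> verts ?\<Gamma>" using False vert by auto
      then have "of_int (\<chi>' \<alpha>) = q * of_int (\<chi> \<alpha>)" by (rule q)
      moreover have "betti s G j \<alpha> = 0" "betti s' G' j \<alpha> = 0" if "j \<le> 2" "j \<noteq> i" for j
      proof -
        have "j = 0 \<or> j = 1 \<or> j = 2" using that by linarith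
        then show "betti s G j \<alpha> = 0"
          using i \<open>j \<noteq> i\<close> False degree_unique[of "fst \<alpha>" "snd \<alpha>"] by auto
        then show "betti s' G' j \<alpha> = 0" using le0 \<open>j \<le> 2\<close> by blast
      qed
      ultimately show ?thesis
        using i unfolding \<chi>_def \<chi>'_def M.euler_def M'.euler_def by auto
    qed
    then have "betti_table s' G' = (\<lambda>i \<alpha>. q * betti_table s G i \<alpha>)"
      by (auto simp: betti_table_def fun_eq_iff)
    then show "\<exists>q::rat. betti_table s' G' = (\<lambda>i \<alpha>. q * betti_table s G i \<alpha>)" by blast
  qed
qed

end
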